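(* Let $0<T<\infty$, and let $\overline{u}$ and $\underline{u}$ be, respectively, a supersolution and a subsolution in $Q_T$ of the problem $$u_t=\Delta u+a u^p\int_\Omega u^q(y,t)\,dy-b u^m,\quad x\in\Omega,\ t>0,$$ $$\frac{\partial u(x,t)}{\partial\nu}=\int_\Omega k(x,y,t)u^l(y,t)\,dy,\quad x\in\partial\Omega,\ t>0,$$ $$u(x,0)=u_0(x),\quad x\in\Omega.$$ If $\min(p,q,l)<1$, suppose in addition that $\underline{u}(x,t)>0$ for all $(x,t)\in Q_T\cup\Gamma_T$ or $\overline{u}(x,t)>0$ for all $(x,t)\in Q_T\cup\Gamma_T$. Then $\overline{u}(x,t)\ge\underline{u}(x,t)$ for all $(x,t)\in Q_T\cup\Gamma_T$.
   Context: $\Omega$ is a bounded domain in $\mathbb{R}^N$, $N\ge1$, with smooth boundary $\partial\Omega$; $\nu$ is the unit outward normal on $\partial\Omega$; $a,b,p,q,m,l$ are positive numbers. The function $k$ satisfies $k\in C(\partial\Omega\times\overline\Omega\times[0,+\infty))$ and $k(x,y,t)\ge0$. The initial datum satisfies $u_0\in C^1(\overline\Omega)$, $u_0\ge0$ in $\Omega$, and $\frac{\partial u_0(x)}{\partial\nu}=\int_\Omega k(x,y,0)u_0^l(y)\,dy$ on $\partial\Omega$. Notation: $Q_T=\Omega\times(0,T)$, $S_T=\partial\Omega\times(0,T)$, $\Gamma_T=S_T\cup(\overline\Omega\times\{0\})$. A nonnegative function $u\in C^{2,1}(Q_T)\cap C^{1,0}(Q_T\cup\Gamma_T)$ is a supersolution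 of the problem in $Q_T$ if (i) $u_t\ge\Delta u+a u^p\int_\Omega u^q(y,t)\,dy-b u^m$ for $(x,t)\in Q_T$; (ii) $\frac{\partial u(x,t)}{\partial\nu}\ge\int_\Omega k(x,y,t)u^l(y,t)\,dy$ for $x\in\partial\Omega$, $0<t<T$; (iii) $u(x,0)\ge u_0(x)$ for $x\in\Omega$. A nonnegative function $u\in C^{2,1}(Q_T)\cap C^{1,0}(Q_T\cup\Gamma_T)$ is a subsolution of the problem in $Q_T$ if it satisfies (i)–(iii) with all inequalities reversed. *)

theory Defs
  imports "HOL-Analysis.Analysis"
begin

definition partial_deriv :: "'a::euclidean_space \<Rightarrow> ('a \<Rightarrow> real) \<Rightarrow> 'a \<Rightarrow> real" where
  "partial_deriv i f x = frechet_derivative f (at x) i"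

definition grad :: "('a::euclidean_space \<Rightarrow> real) \<Rightarrow> 'a \<Rightarrow> 'a" where
  "grad f x = (\<Sum>i\<in>Basis. partial_deriv i f x *\<^sub>R i)"

definition laplacian :: "('a::euclidean_space \<Rightarrow> real) \<Rightarrow> 'a \<Rightarrow> real" where
  "laplacian f x = (\<Sum>i\<in>Basis. partial_deriv i (partial_deriv i f) x)"

text \<open>Intended for open sets \<open>S\<close> only, since derivatives are taken in the full space.\<close>

fun C_k :: "nat \<Rightarrow> 'a::euclidean_space set \<Rightarrow> ('a \<Rightarrow> real) \<Rightarrow> bool" where
  "C_k 0 S f \<longleftrightarrow> continuous_on S f"
| "C_k (Suc n) S f \<longleftrightarrow>
     (\<forall>x\<in>S. f differentiable (at x)) \<and> (\<forall>i\<in>Basis. C_k n S (partial_deriv i f))"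

definition C_infinity :: "'a::euclidean_space set \<Rightarrow> ('a \<Rightarrow> real) \<Rightarrow> bool" where
  "C_infinity S f \<longleftrightarrow> (\<forall>n. C_k n S f)"

definition local_defining_function ::
  "'a::euclidean_space set \<Rightarrow> 'a \<Rightarrow> 'a set \<Rightarrow> ('a \<Rightarrow> real) \<Rightarrow> bool" where
  "local_defining_function \<Omega> x U \<rho> \<longleftrightarrow>
     open U \<and> x \<in> U \<and> C_infinity U \<rho> \<and> (\<forall>y\<in>U. grad \<rho> y \<noteq> 0) \<and>
     \<Omega> \<inter> U = {y\<in>U. \<rho> y < 0} \<and> frontier \<Omega> \<inter> U = {y\<in>U. \<rho> y = 0}"

definition smooth_boundary :: "'a::euclidean_space set \<Rightarrow> bool" where
  "smooth_boundary \<Omega> \<longleftrightarrow> (\<forall>x\<in>frontier \<Omega>. \<exists>U \<rho>. local_defining_function \<Omega> x U \<rho>)"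

text \<open>
  At a boundary point of a domain with smooth boundary the outward unit normal is unique:
  it does not depend on the choice of the local defining function, which is negative inside
  \<open>\<Omega>\<close>, so that its gradient points outwards.
\<close>

definition outward_unit_normal :: "'a::euclidean_space set \<Rightarrow> 'a \<Rightarrow> 'a \<Rightarrow> bool" where
  "outward_unit_normal \<Omega> x n \<longleftrightarrow>
     (\<exists>U \<rho>. local_defining_function \<Omega> x U \<rho> \<and> n = grad \<rho> x /\<^sub>R norm (grad \<rho> x))"

definition bounded_smooth_domain :: "'a::euclidean_space set \<Rightarrow> bool" where
  "bounded_smooth_domain \<Omega> \<longleftrightarrow>
     open \<Omega> \<and> connected \<Omega> \<and> \<Omega> \<noteq> {} \<and> bounded \<Omega> \<and> smooth_boundary \<Omega>"

text \<open>
  A function in \<open>C\<^sup>1\<close> of the closure is one whose first derivatives in \<open>\<Omega>\<close> extend continuously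
  to the closure.  Its derivative at a boundary point in direction \<open>n\<close> is the boundary value
  of the directional derivative \<open>\<nabla>v \<bullet> n\<close> in \<open>\<Omega>\<close>.
\<close>

definition C1_closure :: "'a::euclidean_space set \<Rightarrow> ('a \<Rightarrow> real) \<Rightarrow> bool" where
  "C1_closure \<Omega> v \<longleftrightarrow>
     continuous_on (closure \<Omega>) v \<and> (\<forall>x\<in>\<Omega>. v differentiable (at x)) \<and>
     (\<forall>i\<in>Basis. \<exists>g. continuous_on (closure \<Omega>) g \<and> (\<forall>x\<in>\<Omega>. g x = partial_deriv i v x))"

definition boundary_deriv ::
  "'a::euclidean_space set \<Rightarrow> 'a \<Rightarrow> ('a \<Rightarrow> real) \<Rightarrow> 'a \<Rightarrow> real" where
  "boundary_deriv \<Omega> n v x = Lim (at x within \<Omega>) (\<lambda>y. grad v y \<bullet> n)"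

definition Q_cyl :: "'a::euclidean_space set \<Rightarrow> real \<Rightarrow> ('a \<times> real) set" where
  "Q_cyl \<Omega> T = \<Omega> \<times> {0<..<T}"

definition S_cyl :: "'a::euclidean_space set \<Rightarrow> real \<Rightarrow> ('a \<times> real) set" where
  "S_cyl \<Omega> T = frontier \<Omega> \<times> {0<..<T}"

definition Gamma_cyl :: "'a::euclidean_space set \<Rightarrow> real \<Rightarrow> ('a \<times> real) set" where
  "Gamma_cyl \<Omega> T = S_cyl \<Omega> T \<union> closure \<Omega> \<times> {0}"

definition C21 :: "'a::euclidean_space set \<Rightarrow> real \<Rightarrow> ('a \<Rightarrow> real \<Rightarrow> real) \<Rightarrow> bool" where
  "C21 \<Omega> T u \<longleftrightarrow>
     continuous_on (Q_cyl \<Omega> T) (\<lambda>(x, t). u x t) \<and>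
     (\<forall>(x, t)\<in>Q_cyl \<Omega> T. u x differentiable (at t)) \<and>
     continuous_on (Q_cyl \<Omega> T) (\<lambda>(x, t). deriv (u x) t) \<and>
     (\<forall>(x, t)\<in>Q_cyl \<Omega> T. (\<lambda>y. u y t) differentiable (at x)) \<and>
     (\<forall>i\<in>Basis.
        continuous_on (Q_cyl \<Omega> T) (\<lambda>(x, t). partial_deriv i (\<lambda>y. u y t) x) \<and>
        (\<forall>(x, t)\<in>Q_cyl \<Omega> T. partial_deriv i (\<lambda>y. u y t) differentiable (at x)) \<and>
        (\<forall>j\<in>Basis. continuous_on (Q_cyl \<Omega> T)
           (\<lambda>(x, t). partial_deriv j (partial_deriv i (\<lambda>y. u y t)) x)))"

text \<open>
  Note that \<open>Q_cyl \<Omega> T \<union> Gamma_cyl \<Omega> T\<close> is the closure of \<open>\<Omega>\<close> times \<open>[0, T)\<close>; as above,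
  differentiability up to the lateral boundary means continuous extension of the derivatives.
\<close>

definition C10 :: "'a::euclidean_space set \<Rightarrow> real \<Rightarrow> ('a \<Rightarrow> real \<Rightarrow> real) \<Rightarrow> bool" where
  "C10 \<Omega> T u \<longleftrightarrow>
     continuous_on (Q_cyl \<Omega> T \<union> Gamma_cyl \<Omega> T) (\<lambda>(x, t). u x t) \<and>
     (\<forall>x\<in>\<Omega>. \<forall>t\<in>{0..<T}. (\<lambda>y. u y t) differentiable (at x)) \<and>
     (\<forall>i\<in>Basis. \<exists>g. continuous_on (Q_cyl \<Omega> T \<union> Gamma_cyl \<Omega> T) g \<and>
        (\<forall>x\<in>\<Omega>. \<forall>t\<in>{0..<T}. g (x, t) = partial_deriv i (\<lambda>y. u y t) x))"

definition admissible_kernel ::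
  "'a::euclidean_space set \<Rightarrow> ('a \<Rightarrow> 'a \<Rightarrow> real \<Rightarrow> real) \<Rightarrow> bool" where
  "admissible_kernel \<Omega> k \<longleftrightarrow>
     continuous_on (frontier \<Omega> \<times> closure \<Omega> \<times> {0..}) (\<lambda>(x, y, t). k x y t) \<and>
     (\<forall>x\<in>frontier \<Omega>. \<forall>y\<in>closure \<Omega>. \<forall>t\<ge>0. k x y t \<ge> 0)"

definition admissible_initial_datum ::
  "'a::euclidean_space set \<Rightarrow> ('a \<Rightarrow> 'a) \<Rightarrow> ('a \<Rightarrow> 'a \<Rightarrow> real \<Rightarrow> real) \<Rightarrow> real \<Rightarrow> ('a \<Rightarrow> real) \<Rightarrow> bool"
where
  "admissible_initial_datum \<Omega> \<nu> k l u\<^sub>0 \<longleftrightarrow>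
     C1_closure \<Omega> u\<^sub>0 \<and> (\<forall>x\<in>\<Omega>. u\<^sub>0 x \<ge> 0) \<and>
     (\<forall>x\<in>frontier \<Omega>. boundary_deriv \<Omega> (\<nu> x) u\<^sub>0 x = (LINT y:\<Omega>|lborel. k x y 0 * u\<^sub>0 y powr l))"

definition supersolution ::
  "'a::euclidean_space set \<Rightarrow> ('a \<Rightarrow> 'a) \<Rightarrow> real \<Rightarrow> real \<Rightarrow> real \<Rightarrow> real \<Rightarrow> real \<Rightarrow> real \<Rightarrow>
   ('a \<Rightarrow> 'a \<Rightarrow> real \<Rightarrow> real) \<Rightarrow> ('a \<Rightarrow> real) \<Rightarrow> real \<Rightarrow> ('a \<Rightarrow> real \<Rightarrow> real) \<Rightarrow> bool"
where
  "supersolution \<Omega> \<nu> a b p q m l k u\<^sub>0 T u \<longleftrightarrow>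
     C21 \<Omega> T u \<and> C10 \<Omega> T u \<and>
     (\<forall>(x, t)\<in>Q_cyl \<Omega> T \<union> Gamma_cyl \<Omega> T. u x t \<ge> 0) \<and>
     (\<forall>(x, t)\<in>Q_cyl \<Omega> T. deriv (u x) t \<ge>
        laplacian (\<lambda>y. u y t) x
        + a * u x t powr p * (LINT y:\<Omega>|lborel. u y t powr q) - b * u x t powr m) \<and>
     (\<forall>(x, t)\<in>S_cyl \<Omega> T. boundary_deriv \<Omega> (\<nu> x) (\<lambda>y. u y t) x \<ge>
        (LINT y:\<Omega>|lborel. k x y t * u y t powr l)) \<and>
     (\<forall>x\<in>\<Omega>. u x 0 \<ge> u\<^sub>0 x)"

definition subsolution ::
  "'a::euclidean_space set \<Rightarrow> ('a \<Rightarrow> 'a) \<Rightarrow> real \<Rightarrow> real \<Rightarrow> real \<Rightarrow> real \<Rightarrow> real \<Rightarrow> real \<Rightarrow>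
   ('a \<Rightarrow> 'a \<Rightarrow> real \<Rightarrow> real) \<Rightarrow> ('a \<Rightarrow> real) \<Rightarrow> real \<Rightarrow> ('a \<Rightarrow> real \<Rightarrow> real) \<Rightarrow> bool"
where
  "subsolution \<Omega> \<nu> a b p q m l k u\<^sub>0 T u \<longleftrightarrow>
     C21 \<Omega> T u \<and> C10 \<Omega> T u \<and>
     (\<forall>(x, t)\<in>Q_cyl \<Omega> T \<union> Gamma_cyl \<Omega> T. u x t \<ge> 0) \<and>
     (\<forall>(x, t)\<in>Q_cyl \<Omega> T. deriv (u x) t \<le>
        laplacian (\<lambda>y. u y t) x
        + a * u x t powr p * (LINT y:\<Omega>|lborel. u y t powr q) - b * u x t powr m) \<and>
     (\<forall>(x, t)\<in>S_cyl \<Omega> T. boundary_deriv \<Omega> (\<nu> x) (\<lambda>y. u y t) x \<le>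
        (LINT y:\<Omega>|lborel. k x y t * u y t powr l)) \<and>
     (\<forall>x\<in>\<Omega>. u x 0 \<le> u\<^sub>0 x)"

end

theory Submission
  imports Defs
begin

text \<open>
  Let \<open>\<phi> > 0\<close> be a fixed function of \<open>x\<close> and consider a positive maximum of
  \<open>exp (- \<lambda> t) (u_sub - u_sup) / \<phi>\<close> over the closure of \<open>\<Omega>\<close> times \<open>[0, t1]\<close>.  At its time the
  difference \<open>u_sub - u_sup\<close> is bounded everywhere by a constant multiple \<open>D \<phi>\<close>, with equality at the
  maximum point.  Hence both nonlocal terms are controlled, through the Lipschitz bound for powers,
  by \<open>D\<close>; this is where positivity of one of the two functions enters for exponents below \<open>1\<close>.
  A maximum at an interior point contradicts the differential inequality when \<open>\<lambda>\<close> is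
  large, and one on the lateral boundary contradicts the flux inequality when the normal derivative of
  \<open>\<phi>\<close> exceeds a constant multiple of \<open>sup \<phi>\<close>.
\<close>

section \<open>Functions of class \<open>C_k\<close>\<close>

lemma partial_deriv_eq:
  assumes "(f has_derivative f') (at x)"
  shows "partial_deriv i f x = f' i"
  using frechet_derivative_at[OF assms] by (simp add: partial_deriv_def)

lemma has_derivative_grad:
  fixes f :: "'a::euclidean_space \<Rightarrow> real"
  assumes "f differentiable (at x)"
  shows "(f has_derivative (\<lambda>v. grad f x \<bullet> v)) (at x)"
proof -
  obtain f' where f': "(f has_derivative f') (at x)"
    using assms by (auto simp: differentiable_def)
  then interpret f': bounded_linear f' by (rule has_derivative_bounded_linear)
  have "f' v = grad f x \<bullet> v" for v
  proof -
    have "f' v = f' (\<Sum>i\<in>Basis. (v \<bullet> i) *\<^sub>R i)" by (simp add: euclidean_representation)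
    also have "\<dots> = (\<Sum>i\<in>Basis. (v \<bullet> i) * f' i)" by (simp add: f'.sum f'.scaleR)
    also have "\<dots> = grad f x \<bullet> v"
      by (simp add: grad_def partial_deriv_eq[OF f'] inner_sum_left inner_commute[of v] mult.commute)
    finally show ?thesis .
  qed
  then have "f' = (\<lambda>v. grad f x \<bullet> v)" by auto
  with f' show ?thesis by simp
qed

lemma grad_eq:
  fixes f :: "'a::euclidean_space \<Rightarrow> real"
  assumes "(f has_derivative (\<lambda>v. g \<bullet> v)) (at x)"
  shows "grad f x = g"
  by (simp add: grad_def partial_deriv_eq[OF assms] euclidean_representation)

lemma grad_inner_Basis:
  "i \<in> Basis \<Longrightarrow> grad f x \<bullet> i = partial_deriv i f x"
  by (simp add: grad_def)

lemma partial_deriv_cong: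
  assumes "open S" "x \<in> S" "\<And>y. y \<in> S \<Longrightarrow> f y = g y"
  shows "partial_deriv i f x = partial_deriv i g x"
proof -
  \<comment> \<open>Both functions admit the same derivatives at \<open>x\<close>, so the choice
    inside \<open>frechet_derivative\<close> picks the same one, even where no derivative
    exists.\<close>
  have "(f has_derivative f') (at x) \<longleftrightarrow> (g has_derivative f') (at x)" for f'
    using has_derivative_transform_within_open[OF _ assms(1,2)] assms(3) by metis
  then show ?thesis by (simp add: partial_deriv_def frechet_derivative_def)
qed

text \<open>The recursion of \<open>C_k\<close> passes on \<open>partial_deriv i f\<close>, whereas
  the differentiation rules give a formula for it on \<open>S\<close> only. This lemma lets the
  formula take its place; openness of \<open>S\<close> makes derivatives depend on values in
  \<open>S\<close> alone.\<close>

lemma C_k_cong: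
  assumes "open S" "\<And>y. y \<in> S \<Longrightarrow> f y = g y" "C_k n S f"
  shows "C_k n S g"
  using assms(2,3)
proof (induction n arbitrary: f g)
  case 0
  then show ?case using continuous_on_cong by (metis C_k.simps(1))
next
  case (Suc n)
  have "g differentiable (at x)" if "x \<in> S" for x
  proof -
    obtain f' where "(f has_derivative f') (at x)"
      using Suc.prems(2) \<open>x \<in> S\<close> by (auto simp: differentiable_def)
    then have "(g has_derivative f') (at x)"
      by (rule has_derivative_transform_within_open[OF _ assms(1) that Suc.prems(1)])
    then show ?thesis by (rule differentiableI)
  qed
  moreover have "C_k n S (partial_deriv i g)" if "i \<in> Basis" for i
  proof (rule Suc.IH[of "partial_deriv i f"])
    show "partial_deriv i f y = partial_deriv i g y" if "y \<in> S" for y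
      using assms(1) that Suc.prems(1) by (rule partial_deriv_cong)
    show "C_k n S (partial_deriv i f)" using Suc.prems(2) that by simp
  qed
  ultimately show ?case by simp
qed

text \<open>The derivative of a product or an exponential contains the undifferentiated factors
  again, so the inductions below need them one order lower.\<close>

lemma C_k_Suc_D:
  assumes "C_k (Suc n) S f"
  shows "C_k n S f"
  using assms
proof (induction n arbitrary: f)
  case 0
  then have "f differentiable_on S"
    by (simp add: differentiable_on_def differentiable_at_withinI)
  then show ?case by (simp add: differentiable_imp_continuous_on)
next
  case (Suc n)
  then show ?case by auto
qed

lemma C_k_imp_continuous_on:
  "C_k n S f \<Longrightarrow> continuous_on S f"
  by (induction n) (auto dest!: C_k_Suc_D simp del: C_k.simps(2))

text \<open>Regularity is local. This glues a cut-off function to its extension by zero in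
  \<open>boundary_function_local\<close>.\<close>

lemma C_k_Un:
  assumes "open S" "open S'" "C_k n S f" "C_k n S' f"
  shows "C_k n (S \<union> S') f"
  using assms(3,4)
  by (induction n arbitrary: f) (auto intro: continuous_on_open_Un assms)

lemma C_k_const: "C_k n S (\<lambda>x. c)"
proof (induction n arbitrary: c)
  case 0
  then show ?case by simp
next
  case (Suc n)
  have "partial_deriv i (\<lambda>x. c) = (\<lambda>x. 0)" for i :: 'a
    by (rule ext) (rule partial_deriv_eq[OF has_derivative_const])
  with Suc show ?case by simp
qed

lemma C_k_inner: "C_k n S (\<lambda>x. (x - c) \<bullet> d)"
proof (cases n)
  case 0
  then show ?thesis by (auto intro!: continuous_intros)
next
  case (Suc k)
  have D: "((\<lambda>x. (x - c) \<bullet> d) has_derivative (\<lambda>v. v \<bullet> d)) (at x)" for x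
    by (auto intro!: derivative_eq_intros)
  have "partial_deriv i (\<lambda>x. (x - c) \<bullet> d) = (\<lambda>x. i \<bullet> d)" for i
    by (rule ext) (rule partial_deriv_eq[OF D])
  with Suc D show ?thesis by (auto simp: C_k_const differentiable_def)
qed

lemma C_k_add:
  assumes "open S" "C_k n S f" "C_k n S g"
  shows "C_k n S (\<lambda>x. f x + g x)"
  using assms(2,3)
proof (induction n arbitrary: f g)
  case 0
  then show ?case by (auto intro!: continuous_intros)
next
  case (Suc n)
  have "partial_deriv i (\<lambda>x. f x + g x) x = partial_deriv i f x + partial_deriv i g x"
    if "x \<in> S" for i x
    using Suc.prems that
    by (intro partial_deriv_eq[THEN trans, OF has_derivative_add])
      (auto simp: partial_deriv_def frechet_derivative_works)
  then have "C_k n S (partial_deriv i (\<lambda>x. f x + g x))" if "i \<in> Basis" for i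
    by (rule C_k_cong[OF assms(1) sym Suc.IH]) (use Suc.prems that in simp_all)
  with Suc.prems show ?case by auto
qed

lemma C_k_mult:
  assumes "open S" "C_k n S f" "C_k n S g"
  shows "C_k n S (\<lambda>x. f x * g x)"
  using assms(2,3)
proof (induction n arbitrary: f g)
  case 0
  then show ?case by (auto intro!: continuous_intros)
next
  case (Suc n)
  have D: "partial_deriv i (\<lambda>x. f x * g x) x = f x * partial_deriv i g x + partial_deriv i f x * g x"
    if "x \<in> S" for i x
    using Suc.prems that
    by (intro partial_deriv_eq[THEN trans, OF has_derivative_mult])
      (auto simp: partial_deriv_def frechet_derivative_works)
  have "C_k n S (\<lambda>x. f x * partial_deriv i g x + partial_deriv i f x * g x)"
    if "i \<in> Basis" for i
    using Suc.prems that C_k_Suc_D[OF Suc.prems(1)] C_k_Suc_D[OF Suc.prems(2)]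
    by (intro C_k_add assms(1) Suc.IH) auto
  then have "C_k n S (partial_deriv i (\<lambda>x. f x * g x))" if "i \<in> Basis" for i
    by (rule C_k_cong[OF assms(1), rotated]) (use that in \<open>simp_all only: D\<close>)
  with Suc.prems show ?case by auto
qed

lemma C_k_sum:
  assumes "open S" "\<And>j. j \<in> J \<Longrightarrow> C_k n S (f j)"
  shows "C_k n S (\<lambda>x. \<Sum>j\<in>J. f j x)"
  using assms(2)
  by (induction J rule: infinite_finite_induct) (auto intro: C_k_const C_k_add assms(1))

lemma C_k_exp:
  assumes "open S" "C_k n S f"
  shows "C_k n S (\<lambda>x. exp (f x))"
  using assms(2)
proof (induction n)
  case 0
  then show ?case by (auto intro!: continuous_intros)
next
  case (Suc n)
  have D: "((\<lambda>x. exp (f x)) has_derivative (\<lambda>v. exp (f x) * (grad f x \<bullet> v))) (at x)"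
    if "x \<in> S" for x
    using has_derivative_grad[of f x] that Suc.prems
    by (auto intro!: derivative_eq_intros)
  have "C_k n S (\<lambda>x. exp (f x) * partial_deriv i f x)" if "i \<in> Basis" for i
    using Suc that C_k_Suc_D[OF Suc.prems] by (auto intro: C_k_mult[OF assms(1)])
  then have "C_k n S (partial_deriv i (\<lambda>x. exp (f x)))" if "i \<in> Basis" for i
    by (rule C_k_cong[OF assms(1), rotated])
      (use that in \<open>simp_all only: partial_deriv_eq[OF D] grad_inner_Basis\<close>)
  with D show ?case by (auto simp: differentiable_def)
qed

lemma has_field_derivative_max0_power:
  "((\<lambda>t::real. max 0 t ^ (n + 2)) has_field_derivative (real (n + 2) * max 0 t ^ (n + 1))) (at t)"
proof -
  consider "t < 0" | "t = 0" | "t > 0" by linarith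
  then show ?thesis
  proof cases
    case 1
    have "((\<lambda>t::real. 0) has_field_derivative (real (n + 2) * max 0 t ^ (n + 1))) (at t)"
      using 1 by (auto intro!: derivative_eq_intros)
    then show ?thesis
      by (rule has_field_derivative_transform_within_open[of _ _ _ "{..<0}"]) (use 1 in auto)
  next
    case 2
    \<comment> \<open>Only the origin needs an argument: for \<open>h \<noteq> 0\<close> the
      difference quotient there equals \<open>max 0 h ^ (n + 1)\<close>, which tends to
      \<open>0\<close>.\<close>
    have "((\<lambda>h::real. max 0 h ^ (n + 1)) \<longlongrightarrow> max 0 0 ^ (n + 1)) (at 0)"
      by (intro tendsto_intros)
    then have "((\<lambda>h::real. max 0 h ^ (n + 2) / h) \<longlongrightarrow> 0) (at 0)"
      by (rule Lim_transform_eventually[THEN tendsto_eq_rhs])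
        (auto simp: eventually_at_filter max_def intro!: always_eventually)
    with 2 show ?thesis by (simp add: DERIV_def)
  next
    case 3
    have "((\<lambda>t::real. t ^ (n + 2)) has_field_derivative (real (n + 2) * max 0 t ^ (n + 1))) (at t)"
      using 3 DERIV_pow[of "n + 2" t] by simp
    then show ?thesis
      by (rule has_field_derivative_transform_within_open[of _ _ _ "{0<..}"]) (use 3 in auto)
  qed
qed

text \<open>Each differentiation lowers the power of the positive part by one, so an exponent one
  above the order suffices. This provides compactly supported cut-offs of finite smoothness.\<close>

lemma C_k_max0_power:
  assumes "open S" "C_k n S f"
  shows "C_k n S (\<lambda>x. max 0 (f x) ^ (n + 1))"
  using assms(2)
proof (induction n)
  case 0
  then show ?case by (auto intro!: continuous_intros)
next
  case (Suc n)
  have D: "((\<lambda>x. max 0 (f x) ^ (n + 2)) has_derivative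
      (\<lambda>v. (real (n + 2) * max 0 (f x) ^ (n + 1)) * (grad f x \<bullet> v))) (at x)"
    if "x \<in> S" for x
    using has_derivative_compose[OF has_derivative_grad[of f x]
        has_field_derivative_max0_power[of n "f x", unfolded has_field_derivative_def]] that Suc.prems
    by simp
  have "C_k n S (\<lambda>x. (real (n + 2) * max 0 (f x) ^ (n + 1)) * partial_deriv i f x)"
    if "i \<in> Basis" for i
    using Suc that C_k_Suc_D[OF Suc.prems]
    by (intro C_k_mult[OF assms(1)] C_k_const) auto
  then have "C_k n S (partial_deriv i (\<lambda>x. max 0 (f x) ^ (n + 2)))" if "i \<in> Basis" for i
    by (rule C_k_cong[OF assms(1), rotated])
      (use that in \<open>simp_all only: partial_deriv_eq[OF D] grad_inner_Basis\<close>)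
  moreover have "(\<lambda>x. max 0 (f x) ^ (n + 2)) differentiable (at x)" if "x \<in> S" for x
    using D[OF that] by (rule differentiableI)
  ultimately show ?case by simp
qed

section \<open>Touching points and the outward normal\<close>

text \<open>At the maximum \<open>F' 0 = 0\<close>. If \<open>D > 0\<close>, then \<open>F'\<close>
  is positive just to the right of \<open>0\<close>, and the mean value theorem makes
  \<open>F\<close> exceed \<open>F 0\<close> there.\<close>

lemma second_derivative_test_real:
  fixes F :: "real \<Rightarrow> real"
  assumes "0 < \<delta>"
    and F: "\<And>s. \<bar>s\<bar> < \<delta> \<Longrightarrow> (F has_real_derivative F' s) (at s)"
    and F': "(F' has_real_derivative D) (at 0)"
    and max: "\<And>s. \<bar>s\<bar> < \<delta> \<Longrightarrow> F s \<le> F 0"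
  shows "D \<le> 0"
proof (rule ccontr)
  assume "\<not> D \<le> 0"
  have 0: "F' 0 = 0"
    by (rule DERIV_local_max[OF F[of 0] \<open>0 < \<delta>\<close>]) (use max \<open>0 < \<delta>\<close> in auto)
  obtain d where d: "d > 0" "\<And>h. 0 < h \<Longrightarrow> h < d \<Longrightarrow> F' 0 < F' (0 + h)"
    using DERIV_pos_inc_right[OF F'] \<open>\<not> D \<le> 0\<close> by auto
  define s where "s = min d \<delta> / 2"
  have s: "0 < s" "s < d" "s < \<delta>" using d(1) \<open>0 < \<delta>\<close> by (auto simp: s_def)
  have "\<exists>z>0. z < s \<and> F s - F 0 = (s - 0) * F' z"
    by (rule MVT2) (use s F in auto)
  then obtain z where z: "0 < z" "z < s" "F s - F 0 = s * F' z" by auto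
  have "F' z > 0" using d(2)[of z] z s 0 by auto
  then have "F s > F 0" using z(3) s(1) by (metis mult_pos_pos diff_gt_0_iff_gt)
  with max[of s] s show False by auto
qed

lemma has_real_derivative_along:
  fixes f :: "'a::euclidean_space \<Rightarrow> real"
  assumes "f differentiable (at (x + s *\<^sub>R v))"
  shows "((\<lambda>s. f (x + s *\<^sub>R v)) has_real_derivative (grad f (x + s *\<^sub>R v) \<bullet> v)) (at s)"
proof -
  have "((\<lambda>s. x + s *\<^sub>R v) has_derivative (\<lambda>h. h *\<^sub>R v)) (at s)"
    by (auto intro!: derivative_eq_intros)
  from has_derivative_compose[OF this has_derivative_grad[OF assms]]
  show ?thesis by (simp add: has_field_derivative_def mult_commute_abs)
qed

text \<open>Restricting \<open>f - g - c * h\<close> to the line through \<open>x\<close> in the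
  coordinate direction \<open>i\<close> reduces the claim to the one-variable test.\<close>

lemma partial_deriv_second_le_at_max:
  fixes f g h :: "'a::euclidean_space \<Rightarrow> real"
  assumes "open S" "x \<in> S" "i \<in> Basis"
    and f: "\<And>y. y \<in> S \<Longrightarrow> f differentiable (at y)" "partial_deriv i f differentiable (at x)"
    and g: "\<And>y. y \<in> S \<Longrightarrow> g differentiable (at y)" "partial_deriv i g differentiable (at x)"
    and h: "\<And>y. y \<in> S \<Longrightarrow> h differentiable (at y)" "partial_deriv i h differentiable (at x)"
    and max: "\<And>y. y \<in> S \<Longrightarrow> f y - g y - c * h y \<le> f x - g x - c * h x"
  shows "partial_deriv i (partial_deriv i f) x
    \<le> partial_deriv i (partial_deriv i g) x + c * partial_deriv i (partial_deriv i h) x"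
proof -
  obtain \<delta> where \<delta>: "\<delta> > 0" "ball x \<delta> \<subseteq> S"
    using \<open>open S\<close> \<open>x \<in> S\<close> openE by blast
  have S: "x + s *\<^sub>R i \<in> S" if "\<bar>s\<bar> < \<delta>" for s
    using \<delta>(2) that \<open>i \<in> Basis\<close> by (auto simp: dist_norm)
  have D: "((\<lambda>s. F (x + s *\<^sub>R i)) has_real_derivative partial_deriv i F (x + s *\<^sub>R i)) (at s)"
    if "F differentiable (at (x + s *\<^sub>R i))" for F s
    using has_real_derivative_along[OF that] \<open>i \<in> Basis\<close> by (simp add: grad_inner_Basis)
  have "partial_deriv i (partial_deriv i f) x - partial_deriv i (partial_deriv i g) x
    - c * partial_deriv i (partial_deriv i h) x \<le> 0"
  proof (rule second_derivative_test_real[OF \<delta>(1)])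
    show "((\<lambda>s. f (x + s *\<^sub>R i) - g (x + s *\<^sub>R i) - c * h (x + s *\<^sub>R i)) has_real_derivative
        (\<lambda>s. partial_deriv i f (x + s *\<^sub>R i) - partial_deriv i g (x + s *\<^sub>R i)
          - c * partial_deriv i h (x + s *\<^sub>R i)) s) (at s)"
      if "\<bar>s\<bar> < \<delta>" for s
      using S[OF that] by (intro DERIV_diff DERIV_cmult D f(1) g(1) h(1))
    have "((\<lambda>s. partial_deriv i F (x + s *\<^sub>R i)) has_real_derivative
        partial_deriv i (partial_deriv i F) x) (at 0)" if "partial_deriv i F differentiable (at x)" for F
      using D[of "partial_deriv i F" 0] that by simp
    then show "((\<lambda>s. partial_deriv i f (x + s *\<^sub>R i) - partial_deriv i g (x + s *\<^sub>R i)
          - c * partial_deriv i h (x + s *\<^sub>R i)) has_real_derivative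
        partial_deriv i (partial_deriv i f) x - partial_deriv i (partial_deriv i g) x
          - c * partial_deriv i (partial_deriv i h) x) (at 0)"
      using f(2) g(2) h(2) by (intro DERIV_diff DERIV_cmult) auto
  qed (use S max in auto)
  then show ?thesis by simp
qed

lemma laplacian_le_at_max:
  fixes f g h :: "'a::euclidean_space \<Rightarrow> real"
  assumes "open S" "x \<in> S"
    and "\<And>y. y \<in> S \<Longrightarrow> f differentiable (at y)"
    and "\<And>i. i \<in> Basis \<Longrightarrow> partial_deriv i f differentiable (at x)"
    and "\<And>y. y \<in> S \<Longrightarrow> g differentiable (at y)"
    and "\<And>i. i \<in> Basis \<Longrightarrow> partial_deriv i g differentiable (at x)"
    and "\<And>y. y \<in> S \<Longrightarrow> h differentiable (at y)"
    and "\<And>i. i \<in> Basis \<Longrightarrow> partial_deriv i h differentiable (at x)"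
    and "\<And>y. y \<in> S \<Longrightarrow> f y - g y - c * h y \<le> f x - g x - c * h x"
  shows "laplacian f x \<le> laplacian g x + c * laplacian h x"
  unfolding laplacian_def sum_distrib_left sum.distrib[symmetric]
  using assms by (intro sum_mono partial_deriv_second_le_at_max[where S = S])

lemma grad_linear_combination:
  fixes f g h :: "'a::euclidean_space \<Rightarrow> real"
  assumes "f differentiable (at x)" "g differentiable (at x)" "h differentiable (at x)"
  shows "(\<lambda>y. f y - g y - c * h y) differentiable (at x)"
    and "grad (\<lambda>y. f y - g y - c * h y) x = grad f x - grad g x - c *\<^sub>R grad h x"
proof -
  have "((\<lambda>y. f y - g y - c * h y) has_derivative
      (\<lambda>v. (grad f x - grad g x - c *\<^sub>R grad h x) \<bullet> v)) (at x)"
    using assms[THEN has_derivative_grad]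
    by (auto intro!: derivative_eq_intros simp: inner_diff_left)
  then show "(\<lambda>y. f y - g y - c * h y) differentiable (at x)"
    and "grad (\<lambda>y. f y - g y - c * h y) x = grad f x - grad g x - c *\<^sub>R grad h x"
    by (auto intro: differentiableI grad_eq)
qed

lemma has_real_derivative_along_0:
  fixes f :: "'a::euclidean_space \<Rightarrow> real"
  assumes "f differentiable (at x)"
  shows "((\<lambda>s. f (x + s *\<^sub>R v)) has_real_derivative (grad f x \<bullet> v)) (at 0)"
  using has_real_derivative_along[of f x 0 v] assms by simp

lemma local_defining_function_differentiable:
  assumes "local_defining_function \<Omega> x U \<rho>" "y \<in> U"
  shows "\<rho> differentiable (at y)"
proof -
  have "C_k (Suc 0) U \<rho>"
    using assms(1) unfolding local_defining_function_def C_infinity_def by blast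
  with assms(2) show ?thesis by simp
qed

lemma initial_segment_in_open:
  fixes x v :: "'a::euclidean_space"
  assumes "open U" "x \<in> U"
  obtains d where "d > 0" "\<And>s. 0 < s \<Longrightarrow> s < d \<Longrightarrow> x + s *\<^sub>R v \<in> U"
proof -
  have "((\<lambda>s. x + s *\<^sub>R v) \<longlongrightarrow> x + 0 *\<^sub>R v) (at_right 0)" by (intro tendsto_intros)
  then have "eventually (\<lambda>s. x + s *\<^sub>R v \<in> U) (at_right 0)"
    using assms by (intro topological_tendstoD) auto
  with that show thesis unfolding eventually_at_right_field by auto
qed

text \<open>A negative slope of \<open>\<rho>\<close> along \<open>v\<close>, starting from the
  value \<open>0\<close>, makes \<open>\<rho>\<close> negative for small positive \<open>s\<close>;
  inside \<open>U\<close> this is membership in \<open>\<Omega>\<close>. The exterior version uses a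
  positive slope.\<close>

lemma local_defining_function_along_interior:
  assumes ldf: "local_defining_function \<Omega> x U \<rho>" "\<rho> x = 0" and v: "grad \<rho> x \<bullet> v < 0"
  obtains d where "d > 0" "\<And>s. 0 < s \<Longrightarrow> s < d \<Longrightarrow> x + s *\<^sub>R v \<in> \<Omega>"
proof -
  have U: "open U" "x \<in> U" "\<Omega> \<inter> U = {y\<in>U. \<rho> y < 0}"
    using ldf by (auto simp: local_defining_function_def)
  obtain d1 where d1: "d1 > 0" "\<And>s. 0 < s \<Longrightarrow> s < d1 \<Longrightarrow> x + s *\<^sub>R v \<in> U"
    using initial_segment_in_open[OF U(1,2)] by blast
  have "((\<lambda>s. \<rho> (x + s *\<^sub>R v)) has_real_derivative (grad \<rho> x \<bullet> v)) (at 0)"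
    using local_defining_function_differentiable[OF ldf(1) U(2)] by (rule has_real_derivative_along_0)
  from DERIV_neg_dec_right[OF this v]
  obtain d2 where d2: "d2 > 0" "\<And>s. 0 < s \<Longrightarrow> s < d2 \<Longrightarrow> \<rho> (x + s *\<^sub>R v) < 0"
    using ldf(2) by auto
  show thesis
    by (rule that[of "min d1 d2"]) (use d1 d2 U(3) in auto)
qed

lemma local_defining_function_along_exterior:
  assumes ldf: "local_defining_function \<Omega> x U \<rho>" "\<rho> x = 0" and v: "grad \<rho> x \<bullet> v > 0"
  obtains d where "d > 0" "\<And>s. 0 < s \<Longrightarrow> s < d \<Longrightarrow> x + s *\<^sub>R v \<notin> \<Omega>"
proof -
  have U: "open U" "x \<in> U" "\<Omega> \<inter> U = {y\<in>U. \<rho> y < 0}"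
    using ldf by (auto simp: local_defining_function_def)
  obtain d1 where d1: "d1 > 0" "\<And>s. 0 < s \<Longrightarrow> s < d1 \<Longrightarrow> x + s *\<^sub>R v \<in> U"
    using initial_segment_in_open[OF U(1,2)] by blast
  have "((\<lambda>s. \<rho> (x + s *\<^sub>R v)) has_real_derivative (grad \<rho> x \<bullet> v)) (at 0)"
    using local_defining_function_differentiable[OF ldf(1) U(2)] by (rule has_real_derivative_along_0)
  from DERIV_pos_inc_right[OF this v]
  obtain d2 where d2: "d2 > 0" "\<And>s. 0 < s \<Longrightarrow> s < d2 \<Longrightarrow> \<rho> (x + s *\<^sub>R v) > 0"
    using ldf(2) by auto
  show thesis
    by (rule that[of "min d1 d2"]) (use d1 d2 U(3) in force)+
qed

lemma local_defining_function_zero: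
  "local_defining_function \<Omega> x U \<rho> \<Longrightarrow> x \<in> frontier \<Omega> \<Longrightarrow> \<rho> x = 0"
  unfolding local_defining_function_def by blast

text \<open>Strict case of Cauchy-Schwarz, obtained by expanding the squared norm of
  \<open>e - e'\<close>.\<close>

lemma inner_unit_vectors_less_one:
  fixes e e' :: "'a::real_inner"
  assumes "norm e = 1" "norm e' = 1" "e \<noteq> e'"
  shows "e \<bullet> e' < 1"
proof -
  have "0 < (e - e') \<bullet> (e - e')" using assms(3) by simp
  also have "\<dots> = 2 - 2 * (e \<bullet> e')"
    using assms(1,2) by (simp add: inner_diff_left inner_diff_right inner_commute norm_eq_1)
  finally show ?thesis by simp
qed

text \<open>If two outward unit normals \<open>e\<close> and \<open>n\<close> differed, the direction \<open>n - e\<close> would enter \<open>\<Omega>\<close>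
  according to one defining function and leave it according to the other.\<close>

lemma outward_unit_normal_unique:
  assumes x: "x \<in> frontier \<Omega>" and n: "outward_unit_normal \<Omega> x n"
    and ldf: "local_defining_function \<Omega> x U \<rho>"
  shows "grad \<rho> x = norm (grad \<rho> x) *\<^sub>R n"
proof -
  obtain U' \<rho>' where ldf': "local_defining_function \<Omega> x U' \<rho>'"
    and n_eq: "n = grad \<rho>' x /\<^sub>R norm (grad \<rho>' x)"
    using n by (auto simp: outward_unit_normal_def)
  have nz: "grad \<rho> x \<noteq> 0" "grad \<rho>' x \<noteq> 0"
    using ldf ldf' by (auto simp: local_defining_function_def)
  define e where "e = grad \<rho> x /\<^sub>R norm (grad \<rho> x)"
  have e: "norm e = 1" "norm n = 1" "grad \<rho> x = norm (grad \<rho> x) *\<^sub>R e"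
    "grad \<rho>' x = norm (grad \<rho>' x) *\<^sub>R n"
    using nz by (auto simp: e_def n_eq)
  have "e = n"
  proof (rule ccontr)
    assume "e \<noteq> n"
    then have lt: "e \<bullet> n < 1" by (rule inner_unit_vectors_less_one[OF e(1,2)])
    have "grad \<rho> x \<bullet> (n - e) = norm (grad \<rho> x) * (e \<bullet> n - 1)"
      using e(1) by (subst e(3)) (simp add: inner_diff_right norm_eq_1 algebra_simps)
    then have neg: "grad \<rho> x \<bullet> (n - e) < 0"
      using lt nz by (simp add: mult_pos_neg)
    have "grad \<rho>' x \<bullet> (n - e) = norm (grad \<rho>' x) * (1 - e \<bullet> n)"
      using e(2) by (subst e(4)) (simp add: inner_diff_right norm_eq_1 inner_commute algebra_simps)
    then have pos: "grad \<rho>' x \<bullet> (n - e) > 0"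
      using lt nz by simp
    obtain d where d: "d > 0" "\<And>s. 0 < s \<Longrightarrow> s < d \<Longrightarrow> x + s *\<^sub>R (n - e) \<in> \<Omega>"
      using local_defining_function_along_interior[OF ldf local_defining_function_zero[OF ldf x] neg]
      by blast
    obtain d' where d': "d' > 0" "\<And>s. 0 < s \<Longrightarrow> s < d' \<Longrightarrow> x + s *\<^sub>R (n - e) \<notin> \<Omega>"
      using local_defining_function_along_exterior[OF ldf' local_defining_function_zero[OF ldf' x] pos]
      by blast
    define s where "s = min d d' / 2"
    have "0 < s" "s < d" "s < d'" using d(1) d'(1) by (auto simp: s_def)
    with d(2) d'(2) show False by blast
  qed
  with e(3) show ?thesis by simp
qed

text \<open>Since \<open>n\<close> is the normalized gradient of a defining function
  \<open>\<rho>\<close>, the slope of \<open>\<rho>\<close> along \<open>- n\<close> is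
  \<open>- norm (grad \<rho> x) < 0\<close>.\<close>

lemma inward_segment:
  assumes x: "x \<in> frontier \<Omega>" and n: "outward_unit_normal \<Omega> x n"
  obtains d where "d > 0" "\<And>s. 0 < s \<Longrightarrow> s < d \<Longrightarrow> x - s *\<^sub>R n \<in> \<Omega>"
proof -
  obtain U \<rho> where ldf: "local_defining_function \<Omega> x U \<rho>"
    and n_eq: "n = grad \<rho> x /\<^sub>R norm (grad \<rho> x)"
    using n by (auto simp: outward_unit_normal_def)
  have nz: "grad \<rho> x \<noteq> 0" using ldf by (auto simp: local_defining_function_def)
  have "grad \<rho> x \<bullet> (- n) = - norm (grad \<rho> x)"
    using nz by (simp add: n_eq dot_square_norm power2_eq_square)
  then have "grad \<rho> x \<bullet> (- n) < 0" using nz by simp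
  from local_defining_function_along_interior[OF ldf local_defining_function_zero[OF ldf x] this]
  show thesis using that by (metis add_uminus_conv_diff scaleR_minus_right)
qed

text \<open>The field \<open>G\<close> extends the gradient of \<open>h\<close> continuously,
  because \<open>h\<close> need not be differentiable at \<open>x\<close> itself. If
  \<open>G x \<bullet> n\<close> were negative, \<open>G \<bullet> n\<close> would stay negative on
  a short inward segment, and the mean value theorem along it would give a value of \<open>h\<close>
  above \<open>h x\<close>.\<close>

lemma boundary_gradient_nonneg_at_max:
  fixes h :: "'a::euclidean_space \<Rightarrow> real" and G :: "'a \<Rightarrow> 'a"
  assumes x: "x \<in> frontier \<Omega>" and n: "outward_unit_normal \<Omega> x n"
    and h: "continuous_on (closure \<Omega>) h" "\<And>y. y \<in> \<Omega> \<Longrightarrow> h differentiable (at y)"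
    and G: "continuous_on (closure \<Omega>) G" "\<And>y. y \<in> \<Omega> \<Longrightarrow> grad h y = G y"
    and max: "\<And>y. y \<in> \<Omega> \<Longrightarrow> h y \<le> h x"
  shows "G x \<bullet> n \<ge> 0"
proof (rule ccontr)
  assume "\<not> G x \<bullet> n \<ge> 0"
  then have neg: "G x \<bullet> n < 0" by simp
  obtain d where d: "d > 0" "\<And>s. 0 < s \<Longrightarrow> s < d \<Longrightarrow> x - s *\<^sub>R n \<in> \<Omega>"
    using inward_segment[OF x n] by blast
  have xcl: "x \<in> closure \<Omega>" using x by (auto simp: frontier_def)
  have seg: "x + s *\<^sub>R (- n) \<in> closure \<Omega>" if "s \<in> {0..<d}" for s
    using d(2)[of s] that xcl closure_subset[of \<Omega>] by (cases "s = 0") auto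
  have cont: "continuous_on {0..<d} (\<lambda>s. F (x + s *\<^sub>R (- n)))"
    if "continuous_on (closure \<Omega>) F" for F :: "'a \<Rightarrow> 'b::topological_space"
    by (rule continuous_on_compose2[OF that]) (use seg in \<open>auto intro!: continuous_intros\<close>)
  have "continuous_on {0..<d} (\<lambda>s. G (x + s *\<^sub>R (- n)) \<bullet> n)"
    by (intro continuous_intros cont G(1))
  then have "((\<lambda>s. G (x + s *\<^sub>R (- n)) \<bullet> n) \<longlongrightarrow> G (x + 0 *\<^sub>R (- n)) \<bullet> n) (at 0 within {0..<d})"
    unfolding continuous_on_def by (rule bspec) (use d(1) in simp)
  then have "eventually (\<lambda>s. G (x + s *\<^sub>R (- n)) \<bullet> n < 0) (at 0 within {0..<d})"
    by (rule order_tendstoD) (use neg in simp)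
  then obtain e where e: "e > 0"
      "\<And>s. s \<in> {0..<d} \<Longrightarrow> s \<noteq> 0 \<Longrightarrow> dist s 0 < e \<Longrightarrow> G (x + s *\<^sub>R (- n)) \<bullet> n < 0"
    unfolding eventually_at by blast
  define s where "s = min d e / 2"
  have s: "0 < s" "s < d" "s < e" using d(1) e(1) by (auto simp: s_def)
  have "continuous_on {0..s} (\<lambda>s. h (x + s *\<^sub>R (- n)))"
    by (rule continuous_on_subset[OF cont[OF h(1)]]) (use s in auto)
  moreover have "((\<lambda>s. h (x + s *\<^sub>R (- n))) has_real_derivative
      grad h (x + z *\<^sub>R (- n)) \<bullet> (- n)) (at z)" if "0 < z" "z < s" for z
    by (rule has_real_derivative_along, rule h(2)) (use d(2)[of z] that s in auto)
  ultimately obtain z where z: "0 < z" "z < s"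
    "h (x + s *\<^sub>R (- n)) - h x = s * (grad h (x + z *\<^sub>R (- n)) \<bullet> (- n))"
    using mvt[of 0 s "\<lambda>s. h (x + s *\<^sub>R (- n))"
        "\<lambda>z. (*) (grad h (x + z *\<^sub>R (- n)) \<bullet> (- n))"] s(1)
    unfolding has_field_derivative_def by (auto simp: mult.commute[of s])
  have "grad h (x + z *\<^sub>R (- n)) = G (x + z *\<^sub>R (- n))"
    by (rule G(2)) (use d(2)[of z] z s in auto)
  then have "grad h (x + z *\<^sub>R (- n)) \<bullet> (- n) > 0"
    using e(2)[of z] z s by (simp add: dist_norm)
  then have "h (x + s *\<^sub>R (- n)) > h x"
    using z(3) s(1) by (metis mult_pos_pos diff_gt_0_iff_gt)
  moreover have "h (x + s *\<^sub>R (- n)) \<le> h x"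
    by (rule max) (use d(2)[of s] s in auto)
  ultimately show False by simp
qed

lemma boundary_deriv_eq:
  assumes "open \<Omega>" "x \<in> frontier \<Omega>" "continuous_on (closure \<Omega>) G"
    "\<And>y. y \<in> \<Omega> \<Longrightarrow> grad v y = G y"
  shows "boundary_deriv \<Omega> n v x = G x \<bullet> n"
proof -
  have x: "x \<in> closure \<Omega>" "x \<notin> \<Omega>"
    using assms(1,2) by (auto simp: frontier_def interior_open)
  have "x islimpt \<Omega>" using x by (simp add: closure_def)
  \<comment> \<open>\<open>Lim\<close> is a meaningful value only when limits are unique, hence the
    filter must be nontrivial.\<close>
  then have nt: "at x within \<Omega> \<noteq> bot" using trivial_limit_within by blast
  have "(G \<longlongrightarrow> G x) (at x within \<Omega>)"
    using assms(3) x(1) closure_subset unfolding continuous_on_def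
    by (blast intro: tendsto_within_subset)
  then have "((\<lambda>y. G y \<bullet> n) \<longlongrightarrow> G x \<bullet> n) (at x within \<Omega>)"
    by (intro tendsto_intros)
  then have "((\<lambda>y. grad v y \<bullet> n) \<longlongrightarrow> G x \<bullet> n) (at x within \<Omega>)"
    by (rule Lim_transform_eventually) (auto simp: eventually_at_filter assms(4))
  then show ?thesis
    unfolding boundary_deriv_def by (rule tendsto_Lim[OF nt])
qed

section \<open>A barrier with steep normal derivative\<close>

lemma C_k_dist_squared: "C_k n UNIV (\<lambda>x. (x - z) \<bullet> (x - z))"
  by (subst euclidean_inner) (intro C_k_sum C_k_mult C_k_inner open_UNIV)

text \<open>A cut-off \<open>\<eta>\<close> around \<open>z\<close> times the defining function
  \<open>\<rho>\<close>, extended by zero. On the frontier \<open>\<rho>\<close> vanishes, so the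
  product rule leaves \<open>\<eta> x *\<^sub>R grad \<rho> x\<close>, a nonnegative multiple of the
  outward normal that is nonzero near \<open>z\<close>.\<close>

lemma boundary_function_local:
  fixes \<Omega> :: "'a::euclidean_space set"
  assumes normal: "\<And>x. x \<in> frontier \<Omega> \<Longrightarrow> outward_unit_normal \<Omega> x (\<nu> x)"
    and ldf: "local_defining_function \<Omega> z U \<rho>"
  shows "\<exists>\<theta> W. open W \<and> z \<in> W \<and> C_k 2 UNIV \<theta> \<and> (\<forall>x\<in>\<Omega>. \<theta> x \<le> 0) \<and>
    (\<forall>x\<in>frontier \<Omega>. \<theta> x = 0 \<and> grad \<theta> x = norm (grad \<theta> x) *\<^sub>R \<nu> x) \<and>
    (\<forall>x\<in>frontier \<Omega> \<inter> W. grad \<theta> x \<noteq> 0)"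
proof -
  have U: "open U" "z \<in> U" "\<Omega> \<inter> U = {y\<in>U. \<rho> y < 0}" "frontier \<Omega> \<inter> U = {y\<in>U. \<rho> y = 0}"
    "C_k 2 U \<rho>" "\<And>y. y \<in> U \<Longrightarrow> grad \<rho> y \<noteq> 0"
    using ldf by (auto simp: local_defining_function_def C_infinity_def)
  obtain r where r: "r > 0" "cball z r \<subseteq> U"
    using U(1,2) open_contains_cball by blast
  \<comment> \<open>The cube of the positive part of \<open>r\<^sup>2 - (dist z x)\<^sup>2\<close>:
    twice continuously differentiable, positive in \<open>ball z r\<close> and zero outside
    \<open>cball z r\<close>.\<close>
  define \<eta> where "\<eta> x = max 0 (r\<^sup>2 + (-1) * ((x - z) \<bullet> (x - z))) ^ (2 + 1)" for x
  have \<eta>_C: "C_k 2 S \<eta>" if "open S" for S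
  proof -
    have "C_k 2 UNIV \<eta>"
      unfolding \<eta>_def
      by (intro C_k_max0_power C_k_add C_k_mult C_k_const C_k_dist_squared open_UNIV)
    moreover have "C_k n UNIV f \<Longrightarrow> C_k n S f" for n and f :: "'a \<Rightarrow> real"
      by (induction n arbitrary: f) (auto intro: continuous_on_subset)
    ultimately show ?thesis by blast
  qed
  have \<eta>_nonneg: "\<eta> x \<ge> 0" for x by (simp add: \<eta>_def)
  have dist_sq: "(x - z) \<bullet> (x - z) = (dist z x)\<^sup>2" for x
    by (simp add: dist_norm power2_norm_eq_inner norm_minus_commute)
  have \<eta>_zero: "\<eta> x = 0" if "x \<notin> cball z r" for x
  proof -
    have "r\<^sup>2 \<le> (dist z x)\<^sup>2" by (rule power_mono) (use that r(1) in auto)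
    then show ?thesis by (simp add: \<eta>_def dist_sq)
  qed
  have \<eta>_pos: "\<eta> x > 0" if "x \<in> ball z r" for x
  proof -
    have "(dist z x)\<^sup>2 < r\<^sup>2" by (rule power_strict_mono) (use that in auto)
    then show ?thesis by (simp add: \<eta>_def dist_sq)
  qed
  define \<theta> where "\<theta> x = (if x \<in> U then \<eta> x * \<rho> x else 0)" for x
  have \<theta>_out: "\<theta> x = 0" if "x \<in> - cball z r" for x
    using \<eta>_zero that by (simp add: \<theta>_def)
  have open_out: "open (- cball z r)" by (simp add: open_Compl)
  have "C_k 2 U (\<lambda>x. \<eta> x * \<rho> x)"
    by (intro C_k_mult \<eta>_C U)
  then have "C_k 2 U \<theta>"
    by (rule C_k_cong[OF U(1), rotated]) (simp add: \<theta>_def)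
  moreover have "C_k 2 (- cball z r) \<theta>"
    by (rule C_k_cong[OF open_out _ C_k_const[of _ _ 0]]) (simp add: \<theta>_out)
  \<comment> \<open>The closed ball lies in \<open>U\<close>, so these two open sets cover the whole
    space.\<close>
  ultimately have "C_k 2 (U \<union> - cball z r) \<theta>"
    using C_k_Un U(1) open_out by blast
  moreover have "U \<union> - cball z r = UNIV" using r(2) by auto
  ultimately have \<theta>_C: "C_k 2 UNIV \<theta>" by simp
  have \<theta>_neg: "\<theta> x \<le> 0" if "x \<in> \<Omega>" for x
  proof (cases "x \<in> U")
    case True
    with U(3) that have "\<rho> x < 0" by blast
    with True \<eta>_nonneg[of x] show ?thesis by (simp add: \<theta>_def mult_nonneg_nonpos)
  qed (simp add: \<theta>_def)
  have \<theta>_zero: "\<theta> x = 0" if "x \<in> frontier \<Omega>" for x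
    using U(4) that by (auto simp: \<theta>_def)
  have grad_in: "grad \<theta> x = (\<eta> x * norm (grad \<rho> x)) *\<^sub>R \<nu> x"
    if x: "x \<in> frontier \<Omega>" "x \<in> U" for x
  proof -
    have \<rho>0: "\<rho> x = 0" using U(4) x by auto
    have "\<eta> differentiable (at x)" "\<rho> differentiable (at x)"
      using \<eta>_C[OF open_UNIV] U(5) x(2) by (auto simp: numeral_2_eq_2)
    from has_derivative_mult[OF this[THEN has_derivative_grad]]
    have "((\<lambda>x. \<eta> x * \<rho> x) has_derivative (\<lambda>v. (\<eta> x *\<^sub>R grad \<rho> x) \<bullet> v)) (at x)"
      by (simp add: \<rho>0)
    then have "(\<theta> has_derivative (\<lambda>v. (\<eta> x *\<^sub>R grad \<rho> x) \<bullet> v)) (at x)"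
      by (rule has_derivative_transform_within_open[OF _ U(1) x(2)]) (simp add: \<theta>_def)
    then have "grad \<theta> x = \<eta> x *\<^sub>R grad \<rho> x" by (rule grad_eq)
    \<comment> \<open>The same pair \<open>U\<close>, \<open>\<rho>\<close> serves at every point of
      \<open>U\<close>, so uniqueness of the normal applies at \<open>x\<close> and not just at
      \<open>z\<close>.\<close>
    moreover have "local_defining_function \<Omega> x U \<rho>"
      using ldf x(2) by (auto simp: local_defining_function_def)
    then have "grad \<rho> x = norm (grad \<rho> x) *\<^sub>R \<nu> x"
      by (rule outward_unit_normal_unique[OF x(1) normal[OF x(1)]])
    ultimately show ?thesis by (metis scaleR_scaleR)
  qed
  have grad_out: "grad \<theta> x = 0" if "x \<notin> U" for x
  proof (rule grad_eq)
    have "x \<in> - cball z r" using r(2) that by auto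
    then have "(\<theta> has_derivative (\<lambda>v. 0)) (at x)"
      by (rule has_derivative_transform_within_open[OF has_derivative_const open_out])
        (simp add: \<theta>_out)
    then show "(\<theta> has_derivative (\<lambda>v. 0 \<bullet> v)) (at x)" by simp
  qed
  have norm_\<nu>: "norm (\<nu> x) = 1" if "x \<in> frontier \<Omega>" for x
    using normal[OF that] by (auto simp: outward_unit_normal_def local_defining_function_def)
  have "grad \<theta> x = norm (grad \<theta> x) *\<^sub>R \<nu> x" if "x \<in> frontier \<Omega>" for x
    using grad_in[OF that] grad_out[of x] norm_\<nu>[OF that] \<eta>_nonneg[of x]
    by (cases "x \<in> U") auto
  moreover have "grad \<theta> x \<noteq> 0" if "x \<in> frontier \<Omega> \<inter> ball z r" for x
  proof -
    have x: "x \<in> frontier \<Omega>" "x \<in> U" using that r(2) by auto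
    show ?thesis
      using grad_in[OF x] \<eta>_pos[of x] that U(6)[OF x(2)] norm_\<nu>[OF x(1)] by auto
  qed
  ultimately show ?thesis
    using \<theta>_C \<theta>_neg \<theta>_zero r(1) by (intro exI[of _ \<theta>] exI[of _ "ball z r"]) auto
qed

lemma grad_sum:
  fixes f :: "'i \<Rightarrow> 'a::euclidean_space \<Rightarrow> real"
  assumes "\<And>i. i \<in> I \<Longrightarrow> f i differentiable (at x)"
  shows "grad (\<lambda>x. \<Sum>i\<in>I. f i x) x = (\<Sum>i\<in>I. grad (f i) x)"
  by (rule grad_eq) (use assms in \<open>auto intro!: derivative_eq_intros has_derivative_grad simp: inner_sum_left\<close>)

lemma continuous_on_grad:
  assumes "C_k (Suc n) S f"
  shows "continuous_on S (grad f)"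
  unfolding grad_def using assms
  by (auto intro!: continuous_intros dest: C_k_imp_continuous_on)

text \<open>By compactness finitely many local functions suffice. Their gradients at a frontier
  point are nonnegative multiples of the same normal, so they cannot cancel in the sum, and the
  normal derivative \<open>N\<close> has a positive minimum.\<close>

lemma boundary_function:
  fixes \<Omega> :: "'a::euclidean_space set"
  assumes "bounded_smooth_domain \<Omega>"
    and normal: "\<And>x. x \<in> frontier \<Omega> \<Longrightarrow> outward_unit_normal \<Omega> x (\<nu> x)"
  obtains \<psi> c where "C_k 2 UNIV \<psi>" "c > 0" "\<And>x. x \<in> closure \<Omega> \<Longrightarrow> \<psi> x \<le> 0"
    "\<And>x. x \<in> frontier \<Omega> \<Longrightarrow> \<psi> x = 0" "\<And>x. x \<in> frontier \<Omega> \<Longrightarrow> c \<le> grad \<psi> x \<bullet> \<nu> x"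
proof -
  have cpt: "compact (frontier \<Omega>)"
    using assms(1) by (simp add: bounded_smooth_domain_def compact_frontier_bounded)
  have "\<forall>z\<in>frontier \<Omega>. \<exists>\<theta> W. open W \<and> z \<in> W \<and> C_k 2 UNIV \<theta> \<and> (\<forall>x\<in>\<Omega>. \<theta> x \<le> 0) \<and>
    (\<forall>x\<in>frontier \<Omega>. \<theta> x = 0 \<and> grad \<theta> x = norm (grad \<theta> x) *\<^sub>R \<nu> x) \<and>
    (\<forall>x\<in>frontier \<Omega> \<inter> W. grad \<theta> x \<noteq> 0)"
    using boundary_function_local[OF normal] assms(1)
    unfolding bounded_smooth_domain_def smooth_boundary_def by blast
  then obtain \<theta> W where \<theta>: "\<And>z. z \<in> frontier \<Omega> \<Longrightarrow> open (W z) \<and> z \<in> W z \<and>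
    C_k 2 UNIV (\<theta> z) \<and> (\<forall>x\<in>\<Omega>. \<theta> z x \<le> 0) \<and>
    (\<forall>x\<in>frontier \<Omega>. \<theta> z x = 0 \<and> grad (\<theta> z) x = norm (grad (\<theta> z) x) *\<^sub>R \<nu> x) \<and>
    (\<forall>x\<in>frontier \<Omega> \<inter> W z. grad (\<theta> z) x \<noteq> 0)"
    by metis
  obtain I where I: "I \<subseteq> frontier \<Omega>" "finite I" "frontier \<Omega> \<subseteq> (\<Union>z\<in>I. W z)"
    by (rule compactE_image[OF cpt, of "frontier \<Omega>" W]) (use \<theta> in blast)+
  define \<psi> where "\<psi> x = (\<Sum>z\<in>I. \<theta> z x)" for x
  define N where "N x = (\<Sum>z\<in>I. norm (grad (\<theta> z) x))" for x
  have \<theta>_C: "C_k 2 UNIV (\<theta> z)" if "z \<in> I" for z using \<theta> I(1) that by auto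
  have \<psi>_C: "C_k 2 UNIV \<psi>"
    unfolding \<psi>_def by (intro C_k_sum open_UNIV \<theta>_C)
  have \<psi>_zero: "\<psi> x = 0" if "x \<in> frontier \<Omega>" for x
    unfolding \<psi>_def by (rule sum.neutral) (use \<theta> I(1) that in blast)
  have "\<psi> x \<le> 0" if "x \<in> \<Omega>" for x
    unfolding \<psi>_def by (rule sum_nonpos) (use \<theta> I(1) that in blast)
  then have \<psi>_nonpos: "\<psi> x \<le> 0" if "x \<in> closure \<Omega>" for x
    using that \<psi>_zero[of x] closure_Un_frontier[of \<Omega>] by auto
  have grad_\<psi>: "grad \<psi> x \<bullet> \<nu> x = N x" if x: "x \<in> frontier \<Omega>" for x
  proof -
    have "grad \<psi> x = (\<Sum>z\<in>I. grad (\<theta> z) x)"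
      unfolding \<psi>_def using \<theta>_C by (intro grad_sum) (auto simp: numeral_2_eq_2)
    also have "\<dots> = (\<Sum>z\<in>I. norm (grad (\<theta> z) x) *\<^sub>R \<nu> x)"
      by (rule sum.cong) (use \<theta> I(1) x in blast)+
    also have "\<dots> = N x *\<^sub>R \<nu> x" by (simp add: N_def scaleR_sum_left)
    finally show ?thesis
      using normal[OF x]
      by (auto simp: outward_unit_normal_def local_defining_function_def dot_square_norm power2_eq_square)
  qed
  have N_pos: "N x > 0" if x: "x \<in> frontier \<Omega>" for x
  proof -
    obtain z where "z \<in> I" "x \<in> W z" using I(3) x by auto
    then have "norm (grad (\<theta> z) x) > 0" using \<theta>[of z] I(1) x by auto
    then show ?thesis
      unfolding N_def using \<open>z \<in> I\<close> I(2) by (intro sum_pos2) auto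
  qed
  have "continuous_on (frontier \<Omega>) N"
    unfolding N_def using \<theta>_C
    by (intro continuous_on_sum continuous_on_norm)
      (auto simp: numeral_2_eq_2 simp del: C_k.simps intro: continuous_on_subset[OF continuous_on_grad])
  then have "\<exists>c>0. \<forall>x\<in>frontier \<Omega>. c \<le> N x"
  proof (cases "frontier \<Omega> = {}")
    case True
    \<comment> \<open>A default bound when there is no frontier point.\<close>
    then show ?thesis by (auto intro: exI[of _ 1])
  next
    case False
    from continuous_attains_inf[OF cpt this \<open>continuous_on (frontier \<Omega>) N\<close>]
    show ?thesis using N_pos by blast
  qed
  then obtain c where "c > 0" "\<And>x. x \<in> frontier \<Omega> \<Longrightarrow> c \<le> N x" by blast
  with that[of \<psi> c] \<psi>_C \<psi>_zero \<psi>_nonpos grad_\<psi> show thesis by auto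
qed

text \<open>Through \<open>exp (\<kappa> \<psi>)\<close> with \<open>\<psi> = 0\<close> on the boundary and \<open>\<psi> \<le> 0\<close> inside, the normal derivative
  becomes arbitrarily large while the function stays below \<open>1\<close>.\<close>

lemma steep_barrier:
  fixes \<Omega> :: "'a::euclidean_space set"
  assumes "bounded_smooth_domain \<Omega>"
    and "\<And>x. x \<in> frontier \<Omega> \<Longrightarrow> outward_unit_normal \<Omega> x (\<nu> x)"
    and "K \<ge> 0"
  obtains \<phi> where "C_k 2 UNIV \<phi>" "\<And>x. \<phi> x > 0" "\<And>x. x \<in> closure \<Omega> \<Longrightarrow> \<phi> x \<le> 1"
    "\<And>x. x \<in> frontier \<Omega> \<Longrightarrow> K < grad \<phi> x \<bullet> \<nu> x"
proof -
  obtain \<psi> c where \<psi>: "C_k 2 UNIV \<psi>" "c > 0" "\<And>x. x \<in> closure \<Omega> \<Longrightarrow> \<psi> x \<le> 0"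
    "\<And>x. x \<in> frontier \<Omega> \<Longrightarrow> \<psi> x = 0" "\<And>x. x \<in> frontier \<Omega> \<Longrightarrow> c \<le> grad \<psi> x \<bullet> \<nu> x"
    using boundary_function[OF assms(1,2)] by metis
  \<comment> \<open>On the frontier \<open>exp (\<kappa> * \<psi> x) = 1\<close>, so the normal
    derivative of the barrier is at least \<open>\<kappa> * c = K + 1\<close>.\<close>
  define \<kappa> where "\<kappa> = (K + 1) / c"
  have \<kappa>: "\<kappa> > 0" "\<kappa> * c = K + 1" using \<psi>(2) assms(3) by (auto simp: \<kappa>_def)
  define \<phi> where "\<phi> x = exp (\<kappa> * \<psi> x)" for x
  have "C_k 2 UNIV \<phi>"
    unfolding \<phi>_def by (intro C_k_exp C_k_mult C_k_const \<psi>(1) open_UNIV)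
  moreover have "\<phi> x > 0" for x by (simp add: \<phi>_def)
  moreover have "\<phi> x \<le> 1" if "x \<in> closure \<Omega>" for x
    using \<psi>(3)[OF that] \<kappa>(1) by (simp add: \<phi>_def mult_nonneg_nonpos)
  moreover have "K < grad \<phi> x \<bullet> \<nu> x" if x: "x \<in> frontier \<Omega>" for x
  proof -
    have "\<psi> differentiable (at x)" using \<psi>(1) by (simp add: numeral_2_eq_2)
    note has_derivative_grad[OF this]
    then have "(\<phi> has_derivative (\<lambda>v. (\<kappa> *\<^sub>R grad \<psi> x) \<bullet> v)) (at x)"
      unfolding \<phi>_def using \<psi>(4)[OF x] by (auto intro!: derivative_eq_intros)
    then have "grad \<phi> x = \<kappa> *\<^sub>R grad \<psi> x" by (rule grad_eq)
    moreover have "K + 1 \<le> \<kappa> * (grad \<psi> x \<bullet> \<nu> x)"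
      using mult_left_mono[OF \<psi>(5)[OF x], of \<kappa>] \<kappa> by simp
    ultimately show ?thesis by simp
  qed
  ultimately show thesis by (rule that)
qed

section \<open>Bounds for the nonlocal terms\<close>

text \<open>With \<open>n \<ge> max 1 e\<close> one has \<open>(r/s) powr e \<ge> (r/s)\<^sup>n \<ge> 1 - n (1 - r/s)\<close>.  Only the larger of the
  two arguments has to stay away from \<open>0\<close> when \<open>e < 1\<close>.\<close>

lemma powr_diff_le_linear:
  fixes e c B :: real
  assumes "e > 0" "c > 0"
  obtains L where "L \<ge> 0"
    "\<And>r s. 0 \<le> r \<Longrightarrow> r < s \<Longrightarrow> s \<le> B \<Longrightarrow> (e < 1 \<Longrightarrow> c \<le> s) \<Longrightarrow>
      s powr e - r powr e \<le> L * (s - r)"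
proof -
  \<comment> \<open>On \<open>[0, 1]\<close> the bound \<open>n \<ge> e\<close> gives
    \<open>z powr n \<le> z powr e\<close>. The bound \<open>n \<ge> 1\<close> lets
    \<open>z ^ n\<close> and \<open>z powr n\<close> agree at \<open>z = 0\<close> too.\<close>
  obtain n :: nat where n: "real n \<ge> max 1 e" using real_arch_simple by blast
  \<comment> \<open>The sum bounds \<open>s powr (e - 1)\<close> in both regimes: by the value at
    \<open>B\<close> if \<open>e \<ge> 1\<close>, by the value at \<open>c\<close> if
    \<open>e < 1\<close>.\<close>
  define L where "L = real n * (B powr (e - 1) + c powr (e - 1))"
  have "s powr e - r powr e \<le> L * (s - r)"
    if "0 \<le> r" "r < s" "s \<le> B" and c: "e < 1 \<Longrightarrow> c \<le> s" for r s
  proof -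
    have s: "s > 0" using that by simp
    define z where "z = r / s"
    have z: "0 \<le> z" "z \<le> 1" "r = s * z" using that s by (auto simp: z_def)
    have "1 + real n * (z - 1) \<le> (1 + (z - 1)) ^ n"
      by (rule Bernoulli_inequality) (use z in simp)
    also have "\<dots> = z powr real n" using z(1) n by (subst powr_realpow') auto
    also have "\<dots> \<le> z powr e" by (rule powr_mono') (use n z in auto)
    finally have Bernoulli: "1 - z powr e \<le> real n * (1 - z)" by (simp add: algebra_simps)
    have "s powr (e - 1) \<le> B powr (e - 1) + c powr (e - 1)"
    proof (cases "e < 1")
      case True
      then have "s powr (e - 1) \<le> c powr (e - 1)"
        using c \<open>c > 0\<close> by (intro powr_mono2') auto
      then show ?thesis by (simp add: add_increasing)
    next
      case False
      then have "s powr (e - 1) \<le> B powr (e - 1)"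
        using s \<open>s \<le> B\<close> by (intro powr_mono2) auto
      then show ?thesis by (simp add: add_increasing2)
    qed
    then have le: "real n * s powr (e - 1) * (s - r) \<le> L * (s - r)"
      unfolding L_def using \<open>r < s\<close> by (intro mult_right_mono mult_left_mono) auto
    have "s powr e - r powr e = s powr e * (1 - z powr e)"
      using s z by (simp add: powr_mult algebra_simps)
    also have "\<dots> \<le> s powr e * (real n * (1 - z))"
      using Bernoulli by (intro mult_left_mono) auto
    also have "\<dots> = real n * s powr (e - 1) * (s - r)"
      using s by (simp add: z_def powr_diff field_simps)
    finally show ?thesis using le by linarith
  qed
  moreover have "L \<ge> 0" by (simp add: L_def)
  ultimately show thesis using that by blast
qed

lemma set_integrable_continuous_closure:
  fixes f :: "'a::euclidean_space \<Rightarrow> real"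
  assumes "open \<Omega>" "bounded \<Omega>" "continuous_on (closure \<Omega>) f"
  shows "set_integrable lborel \<Omega> f"
proof (rule set_integrable_subset)
  show "set_integrable lborel (closure \<Omega>) f"
    unfolding set_integrable_def
    by (rule borel_integrable_compact) (use assms in \<open>simp_all add: compact_closure\<close>)
qed (use assms closure_subset in auto)

lemma set_integral_diff_le:
  fixes f g :: "'a::euclidean_space \<Rightarrow> real"
  assumes "open \<Omega>" "bounded \<Omega>" "continuous_on (closure \<Omega>) f" "continuous_on (closure \<Omega>) g"
    and "\<And>y. y \<in> \<Omega> \<Longrightarrow> f y - g y \<le> c"
  shows "(LINT y:\<Omega>|lborel. f y) - (LINT y:\<Omega>|lborel. g y) \<le> c * measure lborel \<Omega>"
proof -
  note int = assms(3,4)[THEN set_integrable_continuous_closure[OF assms(1,2)]]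
    set_integrable_continuous_closure[OF assms(1,2) continuous_on_const[of _ c]]
  have "(LINT y:\<Omega>|lborel. f y) - (LINT y:\<Omega>|lborel. g y) = (LINT y:\<Omega>|lborel. f y - g y)"
    using int by simp
  also have "\<dots> \<le> (LINT y:\<Omega>|lborel. c)"
    by (rule set_integral_mono) (use int assms(5) in auto)
  also have "\<dots> = c * measure lborel \<Omega>"
    using assms(1) emeasure_bounded_finite[OF assms(2)]
    by (subst set_integral_const) (auto simp: mult.commute)
  finally show ?thesis .
qed

lemma Q_cyl_Un_Gamma_cyl:
  assumes "open \<Omega>" "0 < T"
  shows "Q_cyl \<Omega> T \<union> Gamma_cyl \<Omega> T = closure \<Omega> \<times> {0..<T}"
  using assms by (auto simp: Q_cyl_def Gamma_cyl_def S_cyl_def closure_Un_frontier less_le)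

text \<open>\<open>C10\<close> yields a continuous extension for each coordinate; at a fixed time
  these assemble into the vector field needed for the boundary arguments.\<close>

lemma C10_grad:
  fixes u :: "'a::euclidean_space \<Rightarrow> real \<Rightarrow> real"
  assumes "open \<Omega>" "0 < T" "C10 \<Omega> T u" "t \<in> {0..<T}"
  obtains G where "continuous_on (closure \<Omega>) G"
    "\<And>x. x \<in> \<Omega> \<Longrightarrow> grad (\<lambda>y. u y t) x = G x"
proof -
  have "\<forall>i\<in>Basis. \<exists>g. continuous_on (closure \<Omega> \<times> {0..<T}) g \<and>
      (\<forall>x\<in>\<Omega>. \<forall>t\<in>{0..<T}. g (x, t) = partial_deriv i (\<lambda>y. u y t) x)"
    using assms(3) unfolding C10_def Q_cyl_Un_Gamma_cyl[OF assms(1,2)] by blast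
  then obtain g where g: "\<And>i. i \<in> Basis \<Longrightarrow> continuous_on (closure \<Omega> \<times> {0..<T}) (g i)"
    "\<And>i x. i \<in> Basis \<Longrightarrow> x \<in> \<Omega> \<Longrightarrow> g i (x, t) = partial_deriv i (\<lambda>y. u y t) x"
    using assms(4) by metis
  show thesis
  proof (rule that[of "\<lambda>x. \<Sum>i\<in>Basis. g i (x, t) *\<^sub>R i"])
    have "continuous_on (closure \<Omega>) (\<lambda>x. g i (x, t))" if "i \<in> Basis" for i
      by (rule continuous_on_compose2[OF g(1)[OF that]])
        (use assms(4) in \<open>auto intro!: continuous_intros\<close>)
    then show "continuous_on (closure \<Omega>) (\<lambda>x. \<Sum>i\<in>Basis. g i (x, t) *\<^sub>R i)"
      by (intro continuous_intros)
    show "grad (\<lambda>y. u y t) x = (\<Sum>i\<in>Basis. g i (x, t) *\<^sub>R i)" if "x \<in> \<Omega>" for x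
      using g(2) that by (simp add: grad_def)
  qed
qed

lemma C10_continuous:
  assumes "open \<Omega>" "0 < T" "C10 \<Omega> T u"
  shows "continuous_on (closure \<Omega> \<times> {0..<T}) (\<lambda>(x, t). u x t)"
  using assms(3) unfolding C10_def Q_cyl_Un_Gamma_cyl[OF assms(1,2)] by blast

lemma C10_continuous_slice:
  assumes "open \<Omega>" "0 < T" "C10 \<Omega> T u" "t \<in> {0..<T}"
  shows "continuous_on (closure \<Omega>) (\<lambda>x. u x t)"
proof -
  have "continuous_on (closure \<Omega>) (\<lambda>x. (\<lambda>(x, t). u x t) (x, t))"
    by (rule continuous_on_compose2[OF C10_continuous[OF assms(1-3)]])
      (use assms(4) in \<open>auto intro!: continuous_intros\<close>)
  then show ?thesis by simp
qed

lemma compact_bounds: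
  fixes f :: "'b::topological_space \<Rightarrow> real"
  assumes "compact K" "continuous_on K f"
  obtains B where "B > 0" "\<And>x. x \<in> K \<Longrightarrow> f x \<le> B"
proof -
  have "bounded (f ` K)" using assms compact_continuous_image compact_imp_bounded by blast
  then obtain B where "B > 0" "\<forall>y\<in>f ` K. norm y \<le> B" by (auto simp: bounded_pos)
  then show thesis by (intro that[of B]) (auto simp: abs_le_iff)
qed

lemma compact_pos_lower_bound:
  fixes f :: "'b::topological_space \<Rightarrow> real"
  assumes "compact K" "continuous_on K f" "\<And>x. x \<in> K \<Longrightarrow> f x > 0"
  obtains c where "c > 0" "\<And>x. x \<in> K \<Longrightarrow> c \<le> f x"
proof (cases "K = {}")
  case True
  then show thesis using that[of 1] by auto
next
  case False
  then show thesis using continuous_attains_inf[OF assms(1) _ assms(2)] assms(3) that by metis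
qed

section \<open>The comparison principle\<close>

lemma C_k_2_differentiable:
  assumes "C_k 2 UNIV f"
  shows "f differentiable (at x)" and "i \<in> Basis \<Longrightarrow> partial_deriv i f differentiable (at x)"
  using assms by (auto simp: numeral_2_eq_2)

lemma C_k_2_laplacian_continuous:
  assumes "C_k 2 UNIV f"
  shows "continuous_on S (laplacian f)"
proof -
  have "continuous_on UNIV (laplacian f)"
    unfolding laplacian_def using assms by (intro continuous_on_sum) (auto simp: numeral_2_eq_2)
  then show ?thesis by (rule continuous_on_subset) simp
qed

text \<open>At time \<open>t\<close> the function \<open>v - u - M * exp (lam * t) * \<phi>\<close>
  has a spatial maximum at \<open>x\<close>, which compares the Laplacians. At the point
  \<open>x\<close> it is nonpositive up to time \<open>t\<close> and zero at \<open>t\<close>, which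
  bounds its time derivative from below.\<close>

lemma interior_touching:
  fixes u v :: "'a::euclidean_space \<Rightarrow> real \<Rightarrow> real"
  assumes \<Omega>: "open \<Omega>" and v: "C21 \<Omega> T v" and u: "C21 \<Omega> T u" and \<phi>: "C_k 2 UNIV \<phi>"
    and xt: "x \<in> \<Omega>" "0 < t" "t < T"
    and le: "\<And>y s. y \<in> \<Omega> \<Longrightarrow> 0 < s \<Longrightarrow> s \<le> t \<Longrightarrow> v y s - u y s \<le> M * exp (lam * s) * \<phi> y"
    and eq: "v x t - u x t = M * exp (lam * t) * \<phi> x"
  shows "deriv (v x) t - laplacian (\<lambda>y. v y t) x
    \<ge> deriv (u x) t - laplacian (\<lambda>y. u y t) x + M * exp (lam * t) * (lam * \<phi> x - laplacian \<phi> x)"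
proof -
  define D where "D = M * exp (lam * t)"
  have sd: "(\<lambda>y. w y t) differentiable (at y)"
    "i \<in> Basis \<Longrightarrow> partial_deriv i (\<lambda>y. w y t) differentiable (at y)"
    "(w y has_real_derivative deriv (w y) t) (at t)"
    if "C21 \<Omega> T w" "y \<in> \<Omega>" for w :: "'a \<Rightarrow> real \<Rightarrow> real" and y i
  proof -
    have "(y, t) \<in> Q_cyl \<Omega> T" using that(2) xt by (simp add: Q_cyl_def)
    then show "(\<lambda>y. w y t) differentiable (at y)"
      "i \<in> Basis \<Longrightarrow> partial_deriv i (\<lambda>y. w y t) differentiable (at y)"
      "(w y has_real_derivative deriv (w y) t) (at t)"
      using that(1) unfolding C21_def
      by (auto simp: DERIV_deriv_iff_real_differentiable dest!: bspec)
  qed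
  have "laplacian (\<lambda>y. v y t) x \<le> laplacian (\<lambda>y. u y t) x + D * laplacian \<phi> x"
    by (rule laplacian_le_at_max[OF \<Omega> xt(1)])
      (use sd[OF v] sd[OF u] C_k_2_differentiable[OF \<phi>] xt le[of _ t] eq in \<open>auto simp: D_def\<close>)
  moreover have "deriv (v x) t - deriv (u x) t - D * lam * \<phi> x \<ge> 0"
  \<comment> \<open>Times after \<open>t\<close> are not controlled, so the derivative need not
    vanish; a negative one would force positive values just before \<open>t\<close>.\<close>
  proof (rule ccontr)
    assume neg: "\<not> ?thesis"
    have "((\<lambda>s. v x s - u x s - M * exp (lam * s) * \<phi> x) has_real_derivative
        deriv (v x) t - deriv (u x) t - D * lam * \<phi> x) (at t)"
      using sd(3)[OF v xt(1)] sd(3)[OF u xt(1)]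
      by (auto intro!: derivative_eq_intros simp: D_def)
    from DERIV_neg_dec_left[OF this] neg
    obtain d where d: "d > 0" "\<And>h. 0 < h \<Longrightarrow> h < d \<Longrightarrow>
        v x t - u x t - M * exp (lam * t) * \<phi> x
        < v x (t - h) - u x (t - h) - M * exp (lam * (t - h)) * \<phi> x" by auto
    define h where "h = min d t / 2"
    have h: "0 < h" "h < d" "h < t" using d(1) xt by (auto simp: h_def)
    from d(2)[OF h(1,2)] le[OF xt(1), of "t - h"] eq h show False by auto
  qed
  ultimately show ?thesis by (simp add: D_def algebra_simps)
qed

text \<open>The continuous extension of the gradient of \<open>v - u - D * \<phi>\<close> has a
  nonnegative outward component at the maximum point \<open>x\<close>; by
  \<open>boundary_deriv_eq\<close> this is a statement about boundary derivatives.\<close>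

lemma boundary_touching:
  fixes u v :: "'a::euclidean_space \<Rightarrow> real \<Rightarrow> real"
  assumes \<Omega>: "open \<Omega>" "0 < T" and v: "C10 \<Omega> T v" and u: "C10 \<Omega> T u" and \<phi>: "C_k 2 UNIV \<phi>"
    and x: "x \<in> frontier \<Omega>" "outward_unit_normal \<Omega> x n" and t: "t \<in> {0..<T}"
    and le: "\<And>y. y \<in> \<Omega> \<Longrightarrow> v y t - u y t \<le> D * \<phi> y"
    and eq: "v x t - u x t = D * \<phi> x"
  shows "boundary_deriv \<Omega> n (\<lambda>y. v y t) x
    \<ge> boundary_deriv \<Omega> n (\<lambda>y. u y t) x + D * (grad \<phi> x \<bullet> n)"
proof -
  obtain Gv where Gv: "continuous_on (closure \<Omega>) Gv"
    "\<And>x. x \<in> \<Omega> \<Longrightarrow> grad (\<lambda>y. v y t) x = Gv x" using C10_grad[OF \<Omega> v t] by blast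
  obtain Gu where Gu: "continuous_on (closure \<Omega>) Gu"
    "\<And>x. x \<in> \<Omega> \<Longrightarrow> grad (\<lambda>y. u y t) x = Gu x" using C10_grad[OF \<Omega> u t] by blast
  have diff: "(\<lambda>y. v y t) differentiable (at y)" "(\<lambda>y. u y t) differentiable (at y)" if "y \<in> \<Omega>" for y
    using u v t that by (auto simp: C10_def)
  have \<phi>_cont: "continuous_on (closure \<Omega>) \<phi>" "continuous_on (closure \<Omega>) (grad \<phi>)"
    using C_k_imp_continuous_on[OF \<phi>] continuous_on_grad[OF \<phi>[unfolded numeral_2_eq_2]]
    by (auto intro: continuous_on_subset)
  have "(Gv x - Gu x - D *\<^sub>R grad \<phi> x) \<bullet> n \<ge> 0"
  proof (rule boundary_gradient_nonneg_at_max[OF x,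
        where h = "\<lambda>y. v y t - u y t - D * \<phi> y" and G = "\<lambda>y. Gv y - Gu y - D *\<^sub>R grad \<phi> y"])
    show "continuous_on (closure \<Omega>) (\<lambda>y. v y t - u y t - D * \<phi> y)"
      by (intro continuous_intros \<phi>_cont C10_continuous_slice[OF \<Omega>] u v t)
    show "continuous_on (closure \<Omega>) (\<lambda>y. Gv y - Gu y - D *\<^sub>R grad \<phi> y)"
      by (intro continuous_intros \<phi>_cont Gu Gv)
    fix y assume y: "y \<in> \<Omega>"
    show "(\<lambda>y. v y t - u y t - D * \<phi> y) differentiable (at y)"
      "grad (\<lambda>y. v y t - u y t - D * \<phi> y) y = Gv y - Gu y - D *\<^sub>R grad \<phi> y"
      using grad_linear_combination[OF diff[OF y] C_k_2_differentiable(1)[OF \<phi>]] Gv(2) Gu(2) y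
      by auto
    show "v y t - u y t - D * \<phi> y \<le> v x t - u x t - D * \<phi> x"
      using le[OF y] eq by simp
  qed
  then show ?thesis
    using boundary_deriv_eq[OF \<Omega>(1) x(1) Gv] boundary_deriv_eq[OF \<Omega>(1) x(1) Gu]
    by (simp add: inner_diff_left)
qed

theorem theorem2p3:
  fixes \<Omega> :: "'a::euclidean_space set"
    and \<nu> :: "'a \<Rightarrow> 'a"
    and a b p q m l T :: real
    and k :: "'a \<Rightarrow> 'a \<Rightarrow> real \<Rightarrow> real"
    and u\<^sub>0 :: "'a \<Rightarrow> real"
    and u_sup u_sub :: "'a \<Rightarrow> real \<Rightarrow> real"
  assumes "bounded_smooth_domain \<Omega>"
    and "\<And>x. x \<in> frontier \<Omega> \<Longrightarrow> outward_unit_normal \<Omega> x (\<nu> x)"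
    and "a > 0" "b > 0" "p > 0" "q > 0" "m > 0" "l > 0"
    and "admissible_kernel \<Omega> k"
    and "admissible_initial_datum \<Omega> \<nu> k l u\<^sub>0"
    and "0 < T"
    and "supersolution \<Omega> \<nu> a b p q m l k u\<^sub>0 T u_sup"
    and "subsolution \<Omega> \<nu> a b p q m l k u\<^sub>0 T u_sub"
    and "min p (min q l) < 1 \<Longrightarrow>
           (\<forall>(x, t)\<in>Q_cyl \<Omega> T \<union> Gamma_cyl \<Omega> T. u_sub x t > 0) \<or>
           (\<forall>(x, t)\<in>Q_cyl \<Omega> T \<union> Gamma_cyl \<Omega> T. u_sup x t > 0)"
  shows "\<forall>(x, t)\<in>Q_cyl \<Omega> T \<union> Gamma_cyl \<Omega> T. u_sup x t \<ge> u_sub x t"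
proof -
  note normal = assms(2) and pos = assms(3-8) and sup = assms(12) and sub = assms(13)
  have \<Omega>: "open \<Omega>" "bounded \<Omega>" "\<Omega> \<noteq> {}" using assms(1) by (auto simp: bounded_smooth_domain_def)
  note cyl = Q_cyl_Un_Gamma_cyl[OF \<Omega>(1) assms(11)]
  have cl: "compact (closure \<Omega>)" using \<Omega>(2) by simp
  have C10: "C10 \<Omega> T u_sup" "C10 \<Omega> T u_sub" and C21: "C21 \<Omega> T u_sup" "C21 \<Omega> T u_sub"
    using sup sub by (auto simp: supersolution_def subsolution_def)
  note slice = C10_continuous_slice[OF \<Omega>(1) assms(11)]
  have nonneg: "u_sup x t \<ge> 0" "u_sub x t \<ge> 0" if "x \<in> closure \<Omega>" "t \<in> {0..<T}" for x t
    using sup sub that unfolding supersolution_def subsolution_def cyl by auto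
  \<comment> \<open>The functions are controlled on \<open>[0, T)\<close> only. Stopping at
    \<open>t1 < T\<close> gives a compact cylinder on which bounds and maxima exist.\<close>
  have le: "u_sub x1 t1 \<le> u_sup x1 t1" if x1: "x1 \<in> closure \<Omega>" and t1: "0 \<le> t1" "t1 < T" for x1 t1
  proof -

    \<comment> \<open>Uniform bounds and Lipschitz estimates on the compact cylinder\<close>
    define K where "K = closure \<Omega> \<times> {0..t1}"
    have K: "compact K" "K \<noteq> {}" "K \<subseteq> closure \<Omega> \<times> {0..<T}"
      using cl x1 t1 by (auto simp: K_def intro: compact_Times)
    have cont: "continuous_on K (\<lambda>(x, t). u_sup x t)" "continuous_on K (\<lambda>(x, t). u_sub x t)"
      using C10_continuous[OF \<Omega>(1) assms(11)] C10 K(3) by (auto intro: continuous_on_subset)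
    obtain B\<^sub>1 where B\<^sub>1: "B\<^sub>1 > 0" "\<And>z. z \<in> K \<Longrightarrow> (\<lambda>(x, t). u_sup x t) z \<le> B\<^sub>1"
      using compact_bounds[OF K(1) cont(1)] by blast
    obtain B\<^sub>2 where B\<^sub>2: "B\<^sub>2 > 0" "\<And>z. z \<in> K \<Longrightarrow> (\<lambda>(x, t). u_sub x t) z \<le> B\<^sub>2"
      using compact_bounds[OF K(1) cont(2)] by blast
    define B where "B = max B\<^sub>1 B\<^sub>2"
    have B: "B > 0" "\<And>x t. (x, t) \<in> K \<Longrightarrow> u_sup x t \<le> B" "\<And>x t. (x, t) \<in> K \<Longrightarrow> u_sub x t \<le> B"
      using B\<^sub>1 B\<^sub>2 by (fastforce simp: B_def)+
    \<comment> \<open>A lower bound is required only for the larger function where the ordering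
      fails: it comes from the minimum of \<open>u_sub\<close>, or from that of \<open>u_sup\<close>
      because \<open>u_sub > u_sup\<close> there.\<close>
    have "\<exists>c>0. min p (min q l) < 1 \<longrightarrow> (\<forall>(x, t)\<in>K. u_sup x t < u_sub x t \<longrightarrow> c \<le> u_sub x t)"
    proof (cases "min p (min q l) < 1")
      case True
      have "(\<forall>z\<in>K. (\<lambda>(x, t). u_sub x t) z > 0) \<or> (\<forall>z\<in>K. (\<lambda>(x, t). u_sup x t) z > 0)"
        using assms(14)[OF True, unfolded cyl] K(3) by (auto simp: case_prod_beta)
      then show ?thesis
      proof
        assume "\<forall>z\<in>K. (\<lambda>(x, t). u_sub x t) z > 0"
        then obtain c where "c > 0" "\<And>z. z \<in> K \<Longrightarrow> c \<le> (\<lambda>(x, t). u_sub x t) z"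
          using compact_pos_lower_bound[OF K(1) cont(2)] by metis
        then show ?thesis by (intro exI[of _ c]) auto
      next
        assume "\<forall>z\<in>K. (\<lambda>(x, t). u_sup x t) z > 0"
        then obtain c where "c > 0" "\<And>z. z \<in> K \<Longrightarrow> c \<le> (\<lambda>(x, t). u_sup x t) z"
          using compact_pos_lower_bound[OF K(1) cont(1)] by metis
        then show ?thesis by (intro exI[of _ c]) force
      qed
    qed (auto intro: exI[of _ 1])
    then obtain c where c: "c > 0" "\<And>x t. min p (min q l) < 1 \<Longrightarrow> (x, t) \<in> K \<Longrightarrow>
        u_sup x t < u_sub x t \<Longrightarrow> c \<le> u_sub x t" by blast
    have "\<exists>L\<ge>0. \<forall>(x, t)\<in>K. u_sup x t < u_sub x t \<longrightarrow>
        u_sub x t powr e - u_sup x t powr e \<le> L * (u_sub x t - u_sup x t)"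
      if e: "e \<in> {p, q, l}" for e
    proof -
      have "e > 0" using e pos by auto
      from powr_diff_le_linear[OF this c(1), of B]
      obtain L where L: "L \<ge> 0" "\<And>r s. 0 \<le> r \<Longrightarrow> r < s \<Longrightarrow> s \<le> B \<Longrightarrow> (e < 1 \<Longrightarrow> c \<le> s) \<Longrightarrow>
          s powr e - r powr e \<le> L * (s - r)" by blast
      show ?thesis
      proof (intro exI[of _ L] conjI ballI L(1), clarify)
        fix x t assume xt: "(x, t) \<in> K" "u_sup x t < u_sub x t"
        show "u_sub x t powr e - u_sup x t powr e \<le> L * (u_sub x t - u_sup x t)"
          by (rule L(2)) (use xt B nonneg K(3) c(2)[OF _ xt] e in auto)
      qed
    qed
    then obtain L' where L': "\<And>e. e \<in> {p, q, l} \<Longrightarrow> L' e \<ge> 0"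
      "\<And>e x t. e \<in> {p, q, l} \<Longrightarrow> (x, t) \<in> K \<Longrightarrow> u_sup x t < u_sub x t \<Longrightarrow>
        u_sub x t powr e - u_sup x t powr e \<le> L' e * (u_sub x t - u_sup x t)"
      by (metis (no_types, lifting) case_prodD)
    define L where "L = L' p + L' q + L' l"
    have L: "L \<ge> 0" using L' by (simp add: L_def)
    \<comment> \<open>Replacing the difference by any nonnegative upper bound \<open>d\<close>
      covers the points with \<open>u_sub \<le> u_sup\<close> as well, where the left side is
      nonpositive.\<close>
    have Lipschitz: "u_sub x t powr e - u_sup x t powr e \<le> L * d"
      if e: "e \<in> {p, q, l}" and xt: "(x, t) \<in> K" and d: "u_sub x t - u_sup x t \<le> d" "0 \<le> d" for e x t d
    proof (cases "u_sup x t < u_sub x t")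
      case True
      have "L' e \<le> L" using L'(1)[of p] L'(1)[of q] L'(1)[of l] e by (auto simp: L_def)
      have "u_sub x t powr e - u_sup x t powr e \<le> L' e * (u_sub x t - u_sup x t)"
        by (rule L'(2)[OF e xt True])
      also have "\<dots> \<le> L * d"
        using \<open>L' e \<le> L\<close> True L'(1)[OF e] d by (intro mult_mono) auto
      finally show ?thesis .
    next
      case False
      then have "u_sub x t powr e \<le> u_sup x t powr e"
        using e pos nonneg xt K(3) by (intro powr_mono2) auto
      moreover have "0 \<le> L * d" using L d by simp
      ultimately show ?thesis by linarith
    qed

    \<comment> \<open>Choice of the barrier and of the exponential rate\<close>
    have "compact (frontier \<Omega> \<times> closure \<Omega> \<times> {0..t1})"
      using cl \<Omega>(2) by (intro compact_Times) (auto simp: compact_frontier_bounded)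
    moreover have "continuous_on (frontier \<Omega> \<times> closure \<Omega> \<times> {0..t1}) (\<lambda>(x, y, t). k x y t)"
      using assms(9) unfolding admissible_kernel_def by (auto elim: continuous_on_subset)
    ultimately obtain k\<^sub>1 where k\<^sub>1: "k\<^sub>1 > 0"
      "\<And>z. z \<in> frontier \<Omega> \<times> closure \<Omega> \<times> {0..t1} \<Longrightarrow> (\<lambda>(x, y, t). k x y t) z \<le> k\<^sub>1"
      using compact_bounds by metis
    define \<mu> where "\<mu> = measure lborel \<Omega>"
    have \<mu>: "\<mu> \<ge> 0" by (simp add: \<mu>_def)
    \<comment> \<open>If \<open>u_sub - u_sup \<le> D\<close> at some time, the boundary integrals
      differ by at most \<open>D\<close> times this constant; the barrier is chosen steeper than
      that.\<close>
    have "k\<^sub>1 * L * \<mu> \<ge> 0" using k\<^sub>1 L \<mu> by simp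
    then obtain \<phi> where \<phi>: "C_k 2 UNIV \<phi>" "\<And>x. \<phi> x > 0" "\<And>x. x \<in> closure \<Omega> \<Longrightarrow> \<phi> x \<le> 1"
      "\<And>x. x \<in> frontier \<Omega> \<Longrightarrow> k\<^sub>1 * L * \<mu> < grad \<phi> x \<bullet> \<nu> x"
      using steep_barrier[OF assms(1) normal] by metis
    have \<phi>_cont: "continuous_on S \<phi>" for S
      using C_k_imp_continuous_on[OF \<phi>(1)] continuous_on_subset by blast
    obtain \<delta> where \<delta>: "\<delta> > 0" "\<And>x. x \<in> closure \<Omega> \<Longrightarrow> \<delta> \<le> \<phi> x"
      using compact_pos_lower_bound[OF cl \<phi>_cont \<phi>(2)] by blast
    obtain \<Lambda> where \<Lambda>: "\<Lambda> > 0" "\<And>x. x \<in> closure \<Omega> \<Longrightarrow> laplacian \<phi> x \<le> \<Lambda>"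
      using compact_bounds[OF cl C_k_2_laplacian_continuous[OF \<phi>(1)]] by blast
    \<comment> \<open>Bounds, per unit of \<open>D\<close>, the growth of the nonlocal reaction
      term: the first summand for changing the factor with exponent \<open>p\<close>, the second for
      changing the integral.\<close>
    define R where "R = a * (L * (B powr q * \<mu>) + B powr p * (L * \<mu>))"
    have R: "R \<ge> 0" using pos L \<mu> by (simp add: R_def)
    \<comment> \<open>Division by the minimum \<open>\<delta>\<close> of the barrier yields
      \<open>lam * \<phi> \<ge> \<Lambda> + R + 1\<close>; the extra \<open>1\<close> makes the
      interior contradiction strict.\<close>
    define lam where "lam = (\<Lambda> + R + 1) / \<delta>"
    have lam: "\<Lambda> + R + 1 \<le> lam * \<phi> x" if "x \<in> closure \<Omega>" for x
    proof -
      have "lam * \<delta> \<le> lam * \<phi> x"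
        using \<delta>(2)[OF that] \<delta>(1) \<Lambda>(1) R by (intro mult_left_mono) (auto simp: lam_def)
      then show ?thesis using \<delta>(1) by (simp add: lam_def)
    qed

    \<comment> \<open>Maximum of the weighted difference\<close>
    define z where "z = (\<lambda>(x, t). (u_sub x t - u_sup x t) / (exp (lam * t) * \<phi> x))"
    have "continuous_on K z"
    proof -
      have "continuous_on K (\<lambda>w. ((\<lambda>(x, t). u_sub x t) w - (\<lambda>(x, t). u_sup x t) w)
          / (exp (lam * snd w) * \<phi> (fst w)))"
        by (intro continuous_intros cont continuous_on_compose2[OF \<phi>_cont[of UNIV]])
          (auto simp: less_imp_neq[OF \<phi>(2), symmetric])
      then show ?thesis by (simp add: z_def case_prod_beta)
    qed
    from continuous_attains_sup[OF K(1,2) this]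
    obtain x t where xt: "(x, t) \<in> K" and max: "\<And>y s. (y, s) \<in> K \<Longrightarrow> z (y, s) \<le> z (x, t)"
      by (metis surj_pair)
    define M where "M = z (x, t)"
    \<comment> \<open>Clearing the positive denominator turns maximality into the bound and the
      equality that both touching lemmas ask for, whatever the sign of \<open>M\<close>.\<close>
    have cross: "u_sub y s - u_sup y s \<le> M * exp (lam * s) * \<phi> y" if "(y, s) \<in> K" for y s
      using max[OF that] \<phi>(2)[of y] by (simp add: M_def z_def divide_le_eq mult.assoc)
    have touch: "u_sub x t - u_sup x t = M * exp (lam * t) * \<phi> x"
      using \<phi>(2)[of x] by (simp add: M_def z_def)
    have "M \<le> 0"
    proof (rule ccontr)
      assume "\<not> M \<le> 0"
      define D where "D = M * exp (lam * t)"
      have D: "D > 0" using \<open>\<not> M \<le> 0\<close> by (simp add: D_def)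
      have x: "x \<in> closure \<Omega>" and t: "0 \<le> t" "t \<le> t1" using xt by (auto simp: K_def)
      have gt: "u_sup x t < u_sub x t"
        using touch D \<phi>(2)[of x] by (simp add: D_def[symmetric])
          (metis diff_gt_0_iff_gt mult_pos_pos)
      \<comment> \<open>The initial datum orders the functions in \<open>\<Omega>\<close>, and
        continuity extends this to the closure. Hence the maximum is not attained at time
        \<open>0\<close>.\<close>
      have "u_sub y 0 \<le> u_sup y 0" if "y \<in> closure \<Omega>" for y
      proof -
        have cont0: "continuous_on (closure \<Omega>) (\<lambda>x. u_sub x 0 - u_sup x 0)"
          by (intro continuous_intros slice C10) (use assms(11) in auto)
        have "u_sub y 0 - u_sup y 0 \<le> 0"
          by (rule continuous_le_on_closure[OF cont0 that])
            (use sup sub in \<open>force simp: supersolution_def subsolution_def\<close>)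
        then show ?thesis by simp
      qed
      from this[OF x] gt t have t_pos: "0 < t" by (cases "t = 0") auto
      have tT: "t < T" "t \<in> {0..<T}" using t t1 by auto
      have leD: "u_sub y t - u_sup y t \<le> D * \<phi> y" if "y \<in> closure \<Omega>" for y
        using cross[of y t] that t by (simp add: D_def K_def)
      have D1: "u_sub y t powr e - u_sup y t powr e \<le> L * D" if "y \<in> closure \<Omega>" "e \<in> {p, q, l}" for y e
      proof (rule Lipschitz[OF that(2)])
        show "(y, t) \<in> K" using that(1) t by (simp add: K_def)
        have "D * \<phi> y \<le> D * 1" using \<phi>(3)[OF that(1)] D by (intro mult_left_mono) auto
        with leD[OF that(1)] show "u_sub y t - u_sup y t \<le> D" by simp
      qed (use D in simp)
      \<comment> \<open>Positive exponents keep \<open>powr\<close> continuous where the base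
        vanishes.\<close>
      have powr_cont: "continuous_on (closure \<Omega>) (\<lambda>y. u y t powr e)"
        if "u = u_sub \<or> u = u_sup" "e \<in> {p, q, l}" for u e
        using that pos nonneg tT C10 by (intro continuous_on_powr' slice continuous_intros) auto
      show False
      proof (cases "x \<in> \<Omega>")

        \<comment> \<open>Maximum at an interior point\<close>
        case True
        let ?I = "LINT y:\<Omega>|lborel. u_sub y t powr q" and ?J = "LINT y:\<Omega>|lborel. u_sup y t powr q"
        have Q: "(x, t) \<in> Q_cyl \<Omega> T" using True t_pos tT by (simp add: Q_cyl_def)
        have "deriv (u_sup x) t - laplacian (\<lambda>y. u_sup y t) x + D * (lam * \<phi> x - laplacian \<phi> x)
            \<le> deriv (u_sub x) t - laplacian (\<lambda>y. u_sub y t) x"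
          unfolding D_def
          by (rule interior_touching[OF \<Omega>(1) C21(2,1) \<phi>(1) True t_pos tT(1) _ touch], rule cross)
            (use t closure_subset[of \<Omega>] in \<open>auto simp: K_def\<close>)
        moreover have "deriv (u_sup x) t \<ge> laplacian (\<lambda>y. u_sup y t) x
            + a * u_sup x t powr p * ?J - b * u_sup x t powr m"
          using sup Q unfolding supersolution_def by blast
        moreover have "deriv (u_sub x) t \<le> laplacian (\<lambda>y. u_sub y t) x
            + a * u_sub x t powr p * ?I - b * u_sub x t powr m"
          using sub Q unfolding subsolution_def by blast
        \<comment> \<open>The absorption term has a favourable sign at the maximum, so monotonicity
          suffices for every \<open>m > 0\<close>.\<close>
        moreover have "b * u_sup x t powr m \<le> b * u_sub x t powr m"
          using pos gt nonneg(1)[OF x tT(2)] by (intro mult_left_mono powr_mono2) auto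
        moreover have "a * u_sub x t powr p * ?I - a * u_sup x t powr p * ?J \<le> D * R"
        proof -
          \<comment> \<open>Comparison with the zero function bounds the integral itself.\<close>
          have "?I - (LINT y:\<Omega>|lborel. 0) \<le> B powr q * \<mu>"
            unfolding \<mu>_def
            by (rule set_integral_diff_le[OF \<Omega>(1,2) powr_cont continuous_on_const])
              (use B(3) nonneg(2) tT t pos closure_subset[of \<Omega>] in
                \<open>auto simp: K_def subset_iff intro!: powr_mono2\<close>)
          then have I: "?I \<le> B powr q * \<mu>" by (simp add: set_lebesgue_integral_def)
          have I0: "0 \<le> ?I" 
            unfolding set_lebesgue_integral_def by (rule Bochner_Integration.integral_nonneg) simp
          have "?I - ?J \<le> (L * D) * \<mu>"
            unfolding \<mu>_def
            by (rule set_integral_diff_le[OF \<Omega>(1,2) powr_cont powr_cont])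
              (use D1 closure_subset[of \<Omega>] in auto)
          then have "u_sup x t powr p * (?I - ?J) \<le> u_sup x t powr p * ((L * D) * \<mu>)"
            by (rule mult_left_mono) simp
          also have "\<dots> \<le> B powr p * ((L * D) * \<mu>)"
            using B(2)[OF xt] nonneg(1)[OF x tT(2)] pos L D \<mu>
            by (intro mult_right_mono powr_mono2) auto
          finally have J: "u_sup x t powr p * (?I - ?J) \<le> B powr p * ((L * D) * \<mu>)" .
          have "(u_sub x t powr p - u_sup x t powr p) * ?I \<le> (L * D) * ?I"
            using D1[OF x, of p] I0 by (intro mult_right_mono) auto
          also have "\<dots> \<le> (L * D) * (B powr q * \<mu>)"
            using I L D by (intro mult_left_mono) auto
          finally have "(u_sub x t powr p - u_sup x t powr p) * ?I \<le> (L * D) * (B powr q * \<mu>)" .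
          \<comment> \<open>The difference of the products is split by changing one factor at a
            time.\<close>
          with J have "(u_sub x t powr p - u_sup x t powr p) * ?I + u_sup x t powr p * (?I - ?J)
              \<le> (L * D) * (B powr q * \<mu>) + B powr p * ((L * D) * \<mu>)" by linarith
          from mult_left_mono[OF this, of a] pos show ?thesis
            by (simp add: R_def algebra_simps)
        qed
        ultimately have "D * (lam * \<phi> x - laplacian \<phi> x) \<le> D * R" by linarith
        then have "lam * \<phi> x - laplacian \<phi> x \<le> R" using D by simp
        with lam[OF x] \<Lambda>(2)[OF x] show False by linarith
      next

        \<comment> \<open>Maximum on the lateral boundary\<close>
        case False
        then have xf: "x \<in> frontier \<Omega>" using x closure_Un_frontier[of \<Omega>] by auto
        have S: "(x, t) \<in> S_cyl \<Omega> T" using xf t_pos tT by (simp add: S_cyl_def)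
        have k_cont: "continuous_on (closure \<Omega>) (\<lambda>y. k x y t)"
        proof -
          have "continuous_on (frontier \<Omega> \<times> closure \<Omega> \<times> {0..}) (\<lambda>(x, y, t). k x y t)"
            using assms(9) by (simp add: admissible_kernel_def)
          moreover have "continuous_on (closure \<Omega>) (\<lambda>y. (x, y, t))"
            by (intro continuous_intros)
          moreover have "(\<lambda>y. (x, y, t)) ` closure \<Omega> \<subseteq> frontier \<Omega> \<times> closure \<Omega> \<times> {0..}"
            using xf t by auto
          ultimately have "continuous_on (closure \<Omega>) (\<lambda>y. (\<lambda>(x, y, t). k x y t) (x, y, t))"
            by (rule continuous_on_compose2)
          then show ?thesis by simp
        qed
        have "boundary_deriv \<Omega> (\<nu> x) (\<lambda>y. u_sup y t) x + D * (grad \<phi> x \<bullet> \<nu> x)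
            \<le> boundary_deriv \<Omega> (\<nu> x) (\<lambda>y. u_sub y t) x"
          by (rule boundary_touching[OF \<Omega>(1) assms(11) C10(2,1) \<phi>(1) xf normal[OF xf] tT(2)])
            (use leD touch closure_subset[of \<Omega>] in \<open>auto simp: D_def\<close>)
        moreover have "boundary_deriv \<Omega> (\<nu> x) (\<lambda>y. u_sup y t) x
            \<ge> (LINT y:\<Omega>|lborel. k x y t * u_sup y t powr l)"
          using sup S unfolding supersolution_def by blast
        moreover have "boundary_deriv \<Omega> (\<nu> x) (\<lambda>y. u_sub y t) x
            \<le> (LINT y:\<Omega>|lborel. k x y t * u_sub y t powr l)"
          using sub S unfolding subsolution_def by blast
        moreover have "(LINT y:\<Omega>|lborel. k x y t * u_sub y t powr l)
            - (LINT y:\<Omega>|lborel. k x y t * u_sup y t powr l) \<le> (k\<^sub>1 * (L * D)) * \<mu>"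
          unfolding \<mu>_def
        proof (rule set_integral_diff_le[OF \<Omega>(1,2)])
          fix y assume "y \<in> \<Omega>"
          then have y: "y \<in> closure \<Omega>" using closure_subset by blast
          have k: "0 \<le> k x y t" "k x y t \<le> k\<^sub>1"
            using assms(9) xf y t k\<^sub>1(2)[of "(x, y, t)"] by (auto simp: admissible_kernel_def)
          \<comment> \<open>Nonnegativity of the kernel preserves the Lipschitz bound; only then is
            the kernel replaced by its maximum bound \<open>k\<^sub>1\<close>.\<close>
          have "k x y t * (u_sub y t powr l - u_sup y t powr l) \<le> k x y t * (L * D)"
            using D1[OF y, of l] k by (intro mult_left_mono) auto
          also have "\<dots> \<le> k\<^sub>1 * (L * D)"
            using k L D by (intro mult_right_mono) auto
          finally show "k x y t * u_sub y t powr l - k x y t * u_sup y t powr l \<le> k\<^sub>1 * (L * D)"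
            by (simp add: right_diff_distrib)
        qed (auto intro!: continuous_intros k_cont powr_cont)
        ultimately have "D * (grad \<phi> x \<bullet> \<nu> x) \<le> D * (k\<^sub>1 * L * \<mu>)" by (simp add: ac_simps)
        with D \<phi>(4)[OF xf] show False by simp
      qed
    qed
    moreover have "(x1, t1) \<in> K" using x1 t1 by (simp add: K_def)
    then have "u_sub x1 t1 - u_sup x1 t1 \<le> M * (exp (lam * t1) * \<phi> x1)"
      using cross by (simp add: mult.assoc)
    ultimately have "u_sub x1 t1 - u_sup x1 t1 \<le> 0"
      using \<phi>(2)[of x1] by (meson exp_ge_zero less_imp_le mult_nonneg_nonneg mult_nonpos_nonneg order_trans)
    then show ?thesis by simp
  qed
  then show ?thesis unfolding cyl by auto
qed

end
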